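(* Let $\mu$ be a convex measure of noncompactness on an infinite-dimensional real Banach space $X$, let $I=[0,a]$ with $a>0$, let $G\subseteq L_1(I,X)$ be a nonempty bounded subset, and let $\psi\in L_1(I,\mathbb R^+)$ be such that $\sup_{g\in G}\|g(t)\|\le\psi(t)$ for a.e. $t\in I$. Assume that $\mathbb J_G:I\to C_b(\Omega)$ is strongly measurable. Then $t\mapsto\mu\big(G(t)\big)$ is measurable and $$\mu\Big(\int_0^tG(s)\,ds\Big)\le\frac1t\int_0^t\mu\big(tG(s)\big)\,ds,\qquad\forall\,0<t\le a.$$
   Context: $L_1(I,X)$ is the space of Lebesgue–Bochner integrable $X$-valued functions on $I$; $G(t)=\{g(t):g\in G\}$, $tG(s)=\{t\,g(s):g\in G\}$ and $\int_0^tG(s)ds=\{\int_0^tg(s)ds:g\in G\}$. The integral on the right may be $+\infty$. $\Omega=B_{X^*}$ with the norm topology, $C_b(\Omega)$ is the Banach space of bounded continuous real functions on $\Omega$ with the sup-norm, and $\mathbb J_G$ is defined (for a.e. $t$) by $\mathbb J_G(t)(x^* )=\sup_{g\in G}\langle x^*,g(t)\rangle$, $x^*\in\Omega$. Strongly measurable means being the a.e. norm-limit of a sequence of simple functions. $\mathcal B(X)$ is the set of nonempty bounded subsets of $X$. A convex measure of noncompactness on $X$ is a function $\mu:\mathcal B(X)\to[0,\infty)$ such that for all $A,B\in\mathcal B(X)$: (1) $\mu(B)=0$ iff $B$ is relatively compact; (2) $A\supset B$ implies $\mu(A)\ge\mu(B)$; (3) $\mu({\rm co}(B))=\mu(B)$;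 (4) $\mu(\lambda A+(1-\lambda)B)\le\lambda\mu(A)+(1-\lambda)\mu(B)$ for $0\le\lambda\le1$. *)

theory Defs
  imports "HOL-Analysis.Analysis"
begin

section \<open>Strong measurability and the Bochner integral without separability\<close>

definition strongly_measurable :: "'a measure \<Rightarrow> ('a \<Rightarrow> 'b::metric_space) \<Rightarrow> bool" where
  "strongly_measurable M f \<longleftrightarrow>
     (\<exists>s. (\<forall>i. simple_function M (s i)) \<and> (AE t in M. (\<lambda>i. s i t) \<longlonglongrightarrow> f t))"

text \<open>The library's \<open>has_bochner_integral\<close> requires a second countable target space.  The following
  is its definition with Borel measurability replaced by strong measurability, so that it applies to
  arbitrary (also non-separable) Banach spaces.\<close>

definition has_bochner_integral_gen :: "'a measure \<Rightarrow> ('a \<Rightarrow> 'b::real_normed_vector) \<Rightarrow> 'b \<Rightarrow> bool" where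
  "has_bochner_integral_gen M f x \<longleftrightarrow>
     strongly_measurable M f \<and>
     (\<exists>s. (\<forall>i. Bochner_Integration.simple_bochner_integrable M (s i)) \<and>
          (\<lambda>i. \<integral>\<^sup>+ t. ennreal (norm (f t - s i t)) \<partial>M) \<longlonglongrightarrow> 0 \<and>
          (\<lambda>i. Bochner_Integration.simple_bochner_integral M (s i)) \<longlonglongrightarrow> x)"

definition bochner_integrable_gen :: "'a measure \<Rightarrow> ('a \<Rightarrow> 'b::real_normed_vector) \<Rightarrow> bool" where
  "bochner_integrable_gen M f \<longleftrightarrow> (\<exists>x. has_bochner_integral_gen M f x)"

definition bochner_integral_gen :: "'a measure \<Rightarrow> ('a \<Rightarrow> 'b::real_normed_vector) \<Rightarrow> 'b" where
  "bochner_integral_gen M f =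
     (if bochner_integrable_gen M f then THE x. has_bochner_integral_gen M f x else 0)"

text \<open>Families in \<open>L\<^sub>1\<close> are sets of (everywhere defined) representatives; it is for these
  that \<open>{g t |g. g \<in> G}\<close> makes sense.\<close>

definition L1_space :: "'a measure \<Rightarrow> ('a \<Rightarrow> 'b::real_normed_vector) set" where
  "L1_space M = {g. bochner_integrable_gen M g}"

definition L1_bounded :: "'a measure \<Rightarrow> ('a \<Rightarrow> 'b::real_normed_vector) set \<Rightarrow> bool" where
  "L1_bounded M G \<longleftrightarrow> (\<exists>C::real. \<forall>g\<in>G. (\<integral>\<^sup>+ t. ennreal (norm (g t)) \<partial>M) \<le> ennreal C)"


section \<open>The dual unit ball with the norm topology\<close>

typedef (overloaded) ('a::real_normed_vector) dual_ball = "cball (0 :: 'a \<Rightarrow>\<^sub>L real) 1"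
  morphisms functional Dual_ball
  by (rule exI[of _ 0]) simp

instantiation dual_ball :: (real_normed_vector) metric_space
begin

definition dist_dual_ball :: "'a dual_ball \<Rightarrow> 'a dual_ball \<Rightarrow> real" where
  "dist_dual_ball x y = dist (functional x) (functional y)"

definition uniformity_dual_ball :: "('a dual_ball \<times> 'a dual_ball) filter" where
  "uniformity_dual_ball = (INF e\<in>{0 <..}. principal {(x, y). dist x y < e})"

definition open_dual_ball :: "'a dual_ball set \<Rightarrow> bool" where
  "open_dual_ball U = (\<forall>x\<in>U. \<forall>\<^sub>F (x', y) in uniformity. x' = x \<longrightarrow> y \<in> U)"

instance
proof
  fix x y z :: "'a dual_ball"
  show "dist x y = 0 \<longleftrightarrow> x = y"
    by (simp add: dist_dual_ball_def functional_inject)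
  show "dist x y \<le> dist x z + dist y z"
    by (simp add: dist_dual_ball_def dist_triangle2)
qed (simp_all add: uniformity_dual_ball_def open_dual_ball_def)

end

text \<open>The value is only meaningful when \<open>{g t |g. g \<in> G}\<close> is nonempty and bounded; see
  \<open>apply_J_fun\<close> below.\<close>

definition J_fun :: "('t \<Rightarrow> 'a::real_normed_vector) set \<Rightarrow> 't \<Rightarrow> ('a dual_ball \<Rightarrow>\<^sub>C real)" where
  "J_fun G t = Bcontfun (\<lambda>x. SUP g\<in>G. blinfun_apply (functional x) (g t))"

lemma apply_J_fun:
  fixes G :: "('t \<Rightarrow> 'a::real_normed_vector) set"
  assumes "G \<noteq> {}" and C: "\<And>g. g \<in> G \<Longrightarrow> norm (g t) \<le> C"
  shows "apply_bcontfun (J_fun G t) x = (SUP g\<in>G. blinfun_apply (functional x) (g t))"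
proof -
  define h where "h = (\<lambda>x::'a dual_ball. SUP g\<in>G. blinfun_apply (functional x) (g t))"
  obtain g0 where g0: "g0 \<in> G" using assms(1) by blast
  have C0: "0 \<le> C" using C[OF g0] norm_ge_zero order_trans by blast
  have nf: "norm (functional x) \<le> 1" for x :: "'a dual_ball"
    using functional[of x] by simp
  have ap: "\<bar>blinfun_apply f (g t)\<bar> \<le> norm f * C" if "g \<in> G" for f :: "'a \<Rightarrow>\<^sub>L real" and g
    using norm_blinfun[of f "g t"] mult_left_mono[OF C[OF that], of "norm f"] by simp
  have ap1: "\<bar>blinfun_apply (functional x) (g t)\<bar> \<le> C" if "g \<in> G" for x :: "'a dual_ball" and g
    using ap[OF that, of "functional x"] mult_right_mono[OF nf[of x] C0] by simp
  have bdd: "bdd_above ((\<lambda>g. blinfun_apply (functional x) (g t)) ` G)" for x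
    by (rule bdd_aboveI2[of _ _ C]) (use ap1 abs_le_D1 in blast)
  have hb: "\<bar>h x\<bar> \<le> C" for x
  proof -
    have "h x \<le> C"
      unfolding h_def by (rule cSUP_least) (use assms(1) ap1 abs_le_D1 in blast)+
    moreover have "blinfun_apply (functional x) (g0 t) \<le> h x"
      unfolding h_def by (rule cSUP_upper[OF g0 bdd])
    ultimately show ?thesis using ap1[OF g0, of x] by linarith
  qed
  have hl: "h x \<le> h y + C * dist x y" for x y
    unfolding h_def
  proof (rule cSUP_least[OF assms(1)])
    fix g assume g: "g \<in> G"
    have "blinfun_apply (functional x) (g t) - blinfun_apply (functional y) (g t)
        \<le> norm (functional x - functional y) * C"
      using ap[OF g, of "functional x - functional y"] by (simp add: blinfun.diff_left)
    moreover have "blinfun_apply (functional y) (g t)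
        \<le> (SUP g\<in>G. blinfun_apply (functional y) (g t))"
      by (rule cSUP_upper[OF g bdd])
    ultimately show "blinfun_apply (functional x) (g t)
        \<le> (SUP g\<in>G. blinfun_apply (functional y) (g t)) + C * dist x y"
      by (simp add: dist_dual_ball_def dist_norm mult.commute)
  qed
  have "C-lipschitz_on UNIV h"
  proof (rule lipschitz_onI[OF _ C0])
    fix x y show "dist (h x) (h y) \<le> C * dist x y"
      using hl[of x y] hl[of y x] by (simp add: dist_real_def dist_commute abs_le_iff)
  qed
  then have "continuous_on UNIV h" by (rule lipschitz_on_continuous_on)
  moreover have "bounded (range h)"
    using hb by (auto simp: bounded_iff)
  ultimately have "h \<in> bcontfun" by (simp add: bcontfun_def)
  then show ?thesis by (simp add: J_fun_def h_def Bcontfun_inverse)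
qed


section \<open>Convex measures of noncompactness\<close>

text \<open>Only the values of \<open>\<mu>\<close> on nonempty bounded sets are constrained.\<close>

definition convex_mnc :: "('a::real_normed_vector set \<Rightarrow> real) \<Rightarrow> bool" where
  "convex_mnc \<mu> \<longleftrightarrow>
     (\<forall>B. B \<noteq> {} \<and> bounded B \<longrightarrow> 0 \<le> \<mu> B) \<and>
     (\<forall>B. B \<noteq> {} \<and> bounded B \<longrightarrow> (\<mu> B = 0 \<longleftrightarrow> compact (closure B))) \<and>
     (\<forall>A B. A \<noteq> {} \<and> bounded A \<and> B \<noteq> {} \<and> bounded B \<and> B \<subseteq> A \<longrightarrow> \<mu> B \<le> \<mu> A) \<and>
     (\<forall>B. B \<noteq> {} \<and> bounded B \<longrightarrow> \<mu> (convex hull B) = \<mu> B) \<and>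
     (\<forall>A B u. A \<noteq> {} \<and> bounded A \<and> B \<noteq> {} \<and> bounded B \<and> 0 \<le> u \<and> u \<le> 1 \<longrightarrow>
        \<mu> {u *\<^sub>R x + (1 - u) *\<^sub>R y | x y. x \<in> A \<and> y \<in> B} \<le> u * \<mu> A + (1 - u) * \<mu> B)"

end

(* Up to an error rho, a bounded set A lies in the convex hull of B as soon as the support function
   of A exceeds that of B by less than rho on the dual unit ball (Hahn-Banach), and then
   mu A <= mu B + rho * const, because a - b = rho z gives a = (1 - rho) b + rho (b + z).
   So mu (G t) is a locally Lipschitz function of the support function J_fun G t, which yields
   measurability.  For the inequality, cut the interval into countably many measurable pieces on
   which J_fun G varies by less than epsilon: on finitely many of them the integral is compared
   with a convex combination of sets t G(s_i), to which convexity of mu applies, and the remaining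
   pieces carry little of the integral of psi. *)
theory Submission
  imports Defs
begin

section \<open>Separation by functionals of norm at most one\<close>

text \<open>The axioms for \<open>\<mu>\<close> contain neither homogeneity nor subadditivity. Hence
  the factor \<open>t\<close> stays inside \<open>\<mu>\<close>, and sums are admissible only with
  nonnegative weights of total at most 1. Continuity in the Hausdorff distance is not an axiom
  either; convexity supplies it, at the price of the value of \<open>\<mu>\<close> on a ball around
  the set being estimated. Since \<open>\<psi>\<close> is merely integrable, no single radius serves
  all \<open>G t\<close>, so the estimate must involve the radius of one of the two compared sets
  only. The space may be nonseparable. Measurability of vector-valued maps is therefore reached
  through simple approximants, and values of Bochner integrals are reached through scalar integrals
  of functionals of norm at most one. The support functional is exactly what these functionals see
  of \<open>G t\<close>: it determines the set up to its closed convex hull.\<close>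

definition sublinear :: "('a::real_vector \<Rightarrow> real) \<Rightarrow> bool" where
  "sublinear p \<longleftrightarrow>
     (\<forall>x y. p (x + y) \<le> p x + p y) \<and> (\<forall>c x. 0 < c \<longrightarrow> p (c *\<^sub>R x) \<le> c * p x)"

section \<open>Elementary properties of sublinear functionals\<close>

lemma sublinear_add: "sublinear p \<Longrightarrow> p (x + y) \<le> p x + p y"
  by (simp add: sublinear_def)

lemma sublinear_scaleR_le: "sublinear p \<Longrightarrow> 0 < c \<Longrightarrow> p (c *\<^sub>R x) \<le> c * p x"
  by (simp add: sublinear_def)

lemma sublinear_zero:
  assumes "sublinear p" shows "p 0 = 0"
  using sublinear_add[OF assms, of 0 0] sublinear_scaleR_le[OF assms, of "1/2" 0] by simp

text \<open>Using the inequality once more with \<open>inverse c\<close> reverses it. The definition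
  can thus ask for the one-sided form, which infima inherit directly.\<close>

lemma sublinear_scaleR:
  assumes "sublinear p" "0 \<le> c" shows "p (c *\<^sub>R x) = c * p x"
proof (cases "c = 0")
  case False
  then have c: "0 < c" using assms(2) by simp
  have "p x \<le> inverse c * p (c *\<^sub>R x)"
    using sublinear_scaleR_le[OF assms(1), of "inverse c" "c *\<^sub>R x"] c by simp
  then have "c * p x \<le> p (c *\<^sub>R x)"
    using c by (simp add: field_simps)
  then show ?thesis using sublinear_scaleR_le[OF assms(1) c, of x] by simp
qed (simp add: sublinear_zero[OF assms(1)])

lemma sublinear_minus: "sublinear p \<Longrightarrow> - p (- x) \<le> p x"
  using sublinear_add[of p x "- x"] sublinear_zero[of p] by simp

text \<open>The witness is \<open>q x = inf (p (x + v) - r)\<close> over \<open>(v, r)\<close> in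
  the cone, the largest sublinear functional below \<open>p\<close> with the required bounds. The
  hypothesis \<open>r \<le> p v\<close> keeps the infimum above \<open>- p (- x)\<close>. A linear
  functional below \<open>q\<close> then takes a value of at least \<open>r\<close> at
  \<open>v\<close>, which turns constraints on a cone into a Hahn-Banach statement.\<close>

lemma sublinear_cone_inf:
  fixes p :: "'a::real_vector \<Rightarrow> real" and C :: "('a \<times> real) set"
  assumes p: "sublinear p" and C: "convex_cone C"
    and le: "\<And>v r. (v, r) \<in> C \<Longrightarrow> r \<le> p v"
  shows "\<exists>q. sublinear q \<and> q \<le> p \<and> (\<forall>(v, r)\<in>C. q (- v) \<le> - r)"
proof -
  define q where "q = (\<lambda>x. INF k\<in>C. p (x + fst k) - snd k)"
  have C0: "(0, 0) \<in> C"
    using convex_cone_contains_0[OF C] by (simp add: zero_prod_def)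
  then have ne: "C \<noteq> {}" by auto
  have bdd: "bdd_below ((\<lambda>k. p (x + fst k) - snd k) ` C)" for x
  proof (rule bdd_belowI2[of _ "- p (- x)"])
    fix k assume "k \<in> C"
    then have "snd k \<le> p (fst k)" using le[of "fst k" "snd k"] by simp
    also have "\<dots> \<le> p (x + fst k) + p (- x)"
      using sublinear_add[OF p, of "x + fst k" "- x"] by simp
    finally show "- p (- x) \<le> p (x + fst k) - snd k" by simp
  qed
  have qle: "q x \<le> p (x + fst k) - snd k" if "k \<in> C" for x k
    unfolding q_def by (rule cINF_lower[OF bdd that])
  have qge: "c \<le> q x" if "\<And>k. k \<in> C \<Longrightarrow> c \<le> p (x + fst k) - snd k" for x c
    unfolding q_def by (rule cINF_greatest[OF ne that])
  have "sublinear q"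
    unfolding sublinear_def
  proof (intro conjI allI impI)
    fix x y
    have *: "q (x + y) \<le> (p (x + fst k) - snd k) + (p (y + fst l) - snd l)"
      if "k \<in> C" "l \<in> C" for k l
      using qle[OF convex_cone_add[OF C that], of "x + y"]
        sublinear_add[OF p, of "x + fst k" "y + fst l"] by (simp add: algebra_simps)
    \<comment> \<open>The two infima are taken one after the other: first over \<open>l\<close> with
      \<open>k\<close> fixed, then over \<open>k\<close>.\<close>
    have "q (x + y) - (p (x + fst k) - snd k) \<le> q y" if "k \<in> C" for k
      by (rule qge) (use *[OF that] in force)
    then have "q (x + y) - q y \<le> q x" by (intro qge) (force simp: algebra_simps)
    then show "q (x + y) \<le> q x + q y" by simp
  next
    fix c :: real and x :: 'a
    assume c: "0 < c"
    have "q (c *\<^sub>R x) / c \<le> q x"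
    proof (rule qge)
      fix k assume "k \<in> C"
      then have "c *\<^sub>R k \<in> C" using convex_cone_scaleR[OF C] c by simp
      from qle[OF this, of "c *\<^sub>R x"]
      have "q (c *\<^sub>R x) \<le> c * (p (x + fst k) - snd k)"
        using sublinear_scaleR[OF p, of c "x + fst k"] c by (simp add: algebra_simps)
      then show "q (c *\<^sub>R x) / c \<le> p (x + fst k) - snd k"
        using c by (simp add: field_simps)
    qed
    then show "q (c *\<^sub>R x) \<le> c * q x" using c by (simp add: field_simps)
  qed
  moreover have "q \<le> p"
    using qle[OF C0] by (simp add: le_fun_def)
  moreover have "q (- v) \<le> - r" if "(v, r) \<in> C" for v r
    using qle[OF that, of "- v"] sublinear_zero[OF p] by simp
  ultimately show ?thesis by blast
qed

text \<open>Zorn's lemma downwards: the pointwise infimum of a chain is finite because every member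
  lies above \<open>- q (- x)\<close> at \<open>x\<close>, and it is again sublinear.\<close>

lemma sublinear_minimal:
  assumes q: "sublinear q"
  shows "\<exists>m. sublinear m \<and> m \<le> q \<and> (\<forall>p. sublinear p \<and> p \<le> m \<longrightarrow> p = m)"
proof -
  let ?A = "{p. sublinear p \<and> p \<le> q}"
  \<comment> \<open>The order is reversed, since \<open>predicate_Zorn\<close> produces maximal
    elements.\<close>
  let ?P = "\<lambda>p p'. p' \<le> (p :: 'a \<Rightarrow> real)"
  have "\<exists>m\<in>?A. \<forall>p\<in>?A. ?P m p \<longrightarrow> p = m"
  proof (rule predicate_Zorn)
    show "partial_order_on ?A (relation_of ?P ?A)"
      by (rule partial_order_on_relation_ofI) auto
    fix K assume K: "K \<in> Chains (relation_of ?P ?A)"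
    show "\<exists>u\<in>?A. \<forall>p\<in>K. ?P p u"
    proof (cases "K = {}")
      case True
      then show ?thesis using q by auto
    next
      case False
      have KA: "sublinear p" "p \<le> q" if "p \<in> K" for p
        using K that by (auto simp: Chains_def relation_of_def)
      have tot: "p \<le> p' \<or> p' \<le> p" if "p \<in> K" "p' \<in> K" for p p'
        using K that by (auto simp: Chains_def relation_of_def)
      define u where "u = (\<lambda>x. INF p\<in>K. p x)"
      have bdd: "bdd_below ((\<lambda>p. p x) ` K)" for x
      proof (rule bdd_belowI2[of _ "- q (- x)"])
        fix p assume p: "p \<in> K"
        have "p (- x) \<le> q (- x)" using KA(2)[OF p] by (simp add: le_fun_def)
        then show "- q (- x) \<le> p x" using sublinear_minus[OF KA(1)[OF p], of x] by simp
      qed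
      have ule: "u x \<le> p x" if "p \<in> K" for p x
        unfolding u_def by (rule cINF_lower[OF bdd that])
      have uge: "c \<le> u x" if "\<And>p. p \<in> K \<Longrightarrow> c \<le> p x" for x c
        unfolding u_def by (rule cINF_greatest[OF False that])
      have "sublinear u"
        unfolding sublinear_def
      proof (intro conjI allI impI)
        fix x y
        \<comment> \<open>Totality of the chain enters here: the smaller of \<open>p\<close> and
          \<open>p'\<close> serves both arguments.\<close>
        have *: "u (x + y) \<le> p x + p' y" if pp: "p \<in> K" "p' \<in> K" for p p'
        proof -
          obtain m where m: "m \<in> K" "m \<le> p" "m \<le> p'"
            using tot[OF pp] pp by blast
          have "u (x + y) \<le> m x + m y"
            using ule[OF m(1), of "x + y"] sublinear_add[OF KA(1)[OF m(1)], of x y] by simp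
          then show ?thesis using m(2,3)[THEN le_funD] by (smt (verit))
        qed
        have "u (x + y) - p x \<le> u y" if "p \<in> K" for p
          by (rule uge) (use *[OF that] in force)
        then have "u (x + y) - u y \<le> u x" by (intro uge) (force simp: algebra_simps)
        then show "u (x + y) \<le> u x + u y" by simp
      next
        fix c :: real and x :: 'a
        assume c: "0 < c"
        have "u (c *\<^sub>R x) / c \<le> u x"
        proof (rule uge)
          fix p assume p: "p \<in> K"
          have "u (c *\<^sub>R x) \<le> c * p x"
            using ule[OF p, of "c *\<^sub>R x"] sublinear_scaleR_le[OF KA(1)[OF p] c, of x] by simp
          then show "u (c *\<^sub>R x) / c \<le> p x" using c by (simp add: field_simps)
        qed
        then show "u (c *\<^sub>R x) \<le> c * u x" using c by (simp add: field_simps)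
      qed
      moreover obtain p0 where "p0 \<in> K" using False by blast
      then have "u \<le> q" using ule KA(2) by (meson le_fun_def order_trans)
      ultimately show ?thesis using ule by (auto simp: le_fun_def)
    qed
  qed
  then show ?thesis by (auto intro: order_trans)
qed

text \<open>A minimal sublinear functional is linear: lowering it along the ray through \<open>y\<close> must
  not change it, which gives \<open>m x + m y \<le> m (x + y)\<close>.\<close>

lemma sublinear_dominates_linear:
  assumes q: "sublinear q"
  shows "\<exists>f. linear f \<and> f \<le> q"
proof -
  obtain m where m: "sublinear m" "m \<le> q" and min: "\<And>p. sublinear p \<Longrightarrow> p \<le> m \<Longrightarrow> p = m"
    using sublinear_minimal[OF q] by blast
  have add: "m (x + y) = m x + m y" for x y
  proof -
    let ?C = "{(t *\<^sub>R y, t * m y) |t. 0 \<le> t}"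
    have "convex_cone ?C"
      unfolding convex_cone_iff
    proof (intro conjI ballI allI impI)
      show "0 \<in> ?C" by (force simp: zero_prod_def)
      fix k l assume "k \<in> ?C" "l \<in> ?C"
      then obtain s t where "k = (s *\<^sub>R y, s * m y)" "l = (t *\<^sub>R y, t * m y)" "0 \<le> s" "0 \<le> t"
        by blast
      then have "k + l = ((s + t) *\<^sub>R y, (s + t) * m y)" "0 \<le> s + t"
        by (auto simp: algebra_simps)
      then show "k + l \<in> ?C" by blast
    next
      fix k c assume "k \<in> ?C" "0 \<le> (c::real)"
      then obtain s where "k = (s *\<^sub>R y, s * m y)" "0 \<le> s" by blast
      then have "c *\<^sub>R k = ((c * s) *\<^sub>R y, (c * s) * m y)" "0 \<le> c * s"
        using \<open>0 \<le> c\<close> by auto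
      then show "c *\<^sub>R k \<in> ?C" by blast
    qed
    moreover have "r \<le> m v" if "(v, r) \<in> ?C" for v r
      using that sublinear_scaleR[OF m(1)] by auto
    ultimately obtain p where p: "sublinear p" "p \<le> m" "\<forall>(v, r)\<in>?C. p (- v) \<le> - r"
      using sublinear_cone_inf[OF m(1), of ?C] by blast
    have "(y, m y) \<in> ?C" by (auto intro!: exI[of _ 1])
    then have "m (- y) \<le> - m y"
      using p(3) min[OF p(1,2)] by blast
    moreover have "m x \<le> m (x + y) + m (- y)"
      using sublinear_add[OF m(1), of "x + y" "- y"] by simp
    ultimately show ?thesis using sublinear_add[OF m(1), of x y] by simp
  qed
  have "linear m"
  proof (rule linearI)
    fix c x
    have neg: "m (- z) = - m z" for z
      using add[of z "- z"] sublinear_zero[OF m(1)] by simp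
    show "m (c *\<^sub>R x) = c *\<^sub>R m x"
    proof (cases "0 \<le> c")
      case True
      then show ?thesis using sublinear_scaleR[OF m(1)] by simp
    next
      case False
      then show ?thesis
        using sublinear_scaleR[OF m(1), of "- c" x] neg[of "c *\<^sub>R x"] by simp
    qed
  qed (rule add)
  then show ?thesis using m(2) by blast
qed

text \<open>The cone is generated by the pairs \<open>(p - b, \<delta>)\<close>; that
  \<open>B\<close> keeps distance \<open>\<delta>\<close> from \<open>p\<close> says precisely that
  the norm dominates it. A linear functional below the resulting \<open>q\<close> is below the norm,
  hence of norm at most one, and is at least \<open>\<delta>\<close> on every
  \<open>p - b\<close>.\<close>

lemma convex_separation:
  fixes B :: "'a::real_normed_vector set"
  assumes B: "convex B" "B \<noteq> {}" and far: "\<And>b. b \<in> B \<Longrightarrow> \<delta> \<le> norm (p - b)"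
  shows "\<exists>f::'a \<Rightarrow>\<^sub>L real. norm f \<le> 1 \<and> (\<forall>b\<in>B. blinfun_apply f b + \<delta> \<le> blinfun_apply f p)"
proof -
  let ?C = "{(s *\<^sub>R (p - b), s * \<delta>) |s b. 0 \<le> s \<and> b \<in> B}"
  have "sublinear (norm :: 'a \<Rightarrow> real)"
    by (simp add: sublinear_def norm_triangle_ineq)
  moreover have "convex_cone ?C"
    unfolding convex_cone_iff
  proof (intro conjI ballI allI impI)
    show "0 \<in> ?C" using B(2) by (force simp: zero_prod_def)
    fix k l assume "k \<in> ?C" "l \<in> ?C"
    then obtain s b t c where
      kl: "k = (s *\<^sub>R (p - b), s * \<delta>)" "l = (t *\<^sub>R (p - c), t * \<delta>)"
      and st: "0 \<le> s" "0 \<le> t" and bc: "b \<in> B" "c \<in> B" by blast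
    show "k + l \<in> ?C"
    proof (cases "s + t = 0")
      case True
      then have "s = 0" "t = 0" using st by auto
      then have "k + l = (0 *\<^sub>R (p - b), 0 * \<delta>)" using kl by simp
      then show ?thesis using bc by blast
    next
      case False
      \<comment> \<open>The weighted mean of \<open>b\<close> and \<open>c\<close> makes the sum of
        two generators a multiple of a single one; this is where convexity of \<open>B\<close> is
        used.\<close>
      define d where "d = (s / (s + t)) *\<^sub>R b + (t / (s + t)) *\<^sub>R c"
      have "d \<in> B"
        unfolding d_def using B(1) bc st False
        by (intro convexD) (auto simp: add_divide_distrib[symmetric])
      moreover have "(s + t) *\<^sub>R d = s *\<^sub>R b + t *\<^sub>R c"
        unfolding d_def using False by (simp add: scaleR_add_right)
      then have "k + l = ((s + t) *\<^sub>R (p - d), (s + t) * \<delta>)"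
        unfolding kl by (simp add: algebra_simps)
      ultimately show ?thesis using st by (force intro: add_nonneg_nonneg)
    qed
  next
    fix k c assume "k \<in> ?C" "0 \<le> (c::real)"
    then obtain s b where "k = (s *\<^sub>R (p - b), s * \<delta>)" "0 \<le> s" "b \<in> B" by blast
    then have "c *\<^sub>R k = ((c * s) *\<^sub>R (p - b), (c * s) * \<delta>)" "0 \<le> c * s" "b \<in> B"
      using \<open>0 \<le> c\<close> by auto
    then show "c *\<^sub>R k \<in> ?C" by blast
  qed
  moreover have "r \<le> norm v" if "(v, r) \<in> ?C" for v r
    using that by (auto intro!: mult_left_mono far)
  ultimately obtain q :: "'a \<Rightarrow> real"
    where q: "sublinear q" "q \<le> norm" "\<forall>(v, r)\<in>?C. q (- v) \<le> - r"
    using sublinear_cone_inf[of norm ?C] by blast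
  obtain f where f: "linear f" "f \<le> q" using sublinear_dominates_linear[OF q(1)] by blast
  interpret linear f by (rule f(1))
  have fle: "f x \<le> norm x" for x
    using f(2) q(2) by (meson le_fun_def order_trans)
  have fabs: "norm (f x) \<le> norm x * 1" for x
    using fle[of x] fle[of "- x"] by (simp add: neg)
  have bl: "bounded_linear f"
    by (rule bounded_linear_intro[where K = 1]) (use add scale fabs in auto)
  then have app: "blinfun_apply (Blinfun f) x = f x" for x
    by (simp add: bounded_linear_Blinfun_apply)
  have "norm (Blinfun f) \<le> 1"
    using fabs by (intro norm_blinfun_bound) (auto simp: app)
  moreover have "blinfun_apply (Blinfun f) b + \<delta> \<le> blinfun_apply (Blinfun f) p" if "b \<in> B" for b
  proof -
    have "(1 *\<^sub>R (p - b), 1 * \<delta>) \<in> ?C" using that zero_le_one by blast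
    from bspec[OF q(3) this] have "q (- (p - b)) \<le> - \<delta>" by simp
    then have "f (- (p - b)) \<le> - \<delta>" using f(2) by (meson le_fun_def order_trans)
    then show ?thesis unfolding app by (simp add: diff)
  qed
  ultimately show ?thesis by blast
qed

text \<open>Separating \<open>x\<close> from \<open>{0}\<close> at distance \<open>norm x\<close>
  yields a norming functional.\<close>

lemma norm_le_if_functionals_le:
  fixes x :: "'a::real_normed_vector"
  assumes "\<And>f::'a \<Rightarrow>\<^sub>L real. norm f \<le> 1 \<Longrightarrow> blinfun_apply f x \<le> r"
  shows "norm x \<le> r"
proof -
  obtain f :: "'a \<Rightarrow>\<^sub>L real" where "norm f \<le> 1" "blinfun_apply f 0 + norm x \<le> blinfun_apply f x"
    using convex_separation[of "{0}" "norm x" x] by auto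
  then show ?thesis using assms[of f] by simp
qed

section \<open>Convex measures of noncompactness\<close>

context
  fixes \<mu> :: "'a::real_normed_vector set \<Rightarrow> real"
  assumes mnc: "convex_mnc \<mu>"
begin

lemma mnc_nonneg: "B \<noteq> {} \<Longrightarrow> bounded B \<Longrightarrow> 0 \<le> \<mu> B"
  using mnc[unfolded convex_mnc_def, THEN conjunct1] by simp

lemma mnc_mono: "B \<noteq> {} \<Longrightarrow> bounded A \<Longrightarrow> B \<subseteq> A \<Longrightarrow> \<mu> B \<le> \<mu> A"
  using mnc[unfolded convex_mnc_def, THEN conjunct2, THEN conjunct2, THEN conjunct1,
      rule_format, of A B] bounded_subset[of A B] by auto

lemma mnc_convex_hull: "B \<noteq> {} \<Longrightarrow> bounded B \<Longrightarrow> \<mu> (convex hull B) = \<mu> B"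
  using mnc[unfolded convex_mnc_def, THEN conjunct2, THEN conjunct2, THEN conjunct2,
      THEN conjunct1] by simp

lemma mnc_convex:
  "A \<noteq> {} \<Longrightarrow> bounded A \<Longrightarrow> B \<noteq> {} \<Longrightarrow> bounded B \<Longrightarrow> 0 \<le> u \<Longrightarrow> u \<le> 1 \<Longrightarrow>
    \<mu> {u *\<^sub>R x + (1 - u) *\<^sub>R y | x y. x \<in> A \<and> y \<in> B} \<le> u * \<mu> A + (1 - u) * \<mu> B"
  by (rule mnc[unfolded convex_mnc_def, THEN conjunct2, THEN conjunct2, THEN conjunct2,
      THEN conjunct2, rule_format]) simp

lemma mnc_singleton: "\<mu> {x} = 0"
  using mnc[unfolded convex_mnc_def, THEN conjunct2, THEN conjunct1, rule_format, of "{x}"]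
  by simp

lemma bounded_convex_combination:
  fixes A B :: "'b::real_normed_vector set"
  assumes "bounded A" "bounded B"
  shows "bounded {u *\<^sub>R x + v *\<^sub>R y | x y. x \<in> A \<and> y \<in> B}"
proof -
  obtain a b where "\<And>x. x \<in> A \<Longrightarrow> norm x \<le> a" "\<And>y. y \<in> B \<Longrightarrow> norm y \<le> b"
    using assms unfolding bounded_iff by blast
  then have "norm (u *\<^sub>R x + v *\<^sub>R y) \<le> \<bar>u\<bar> * a + \<bar>v\<bar> * b" if "x \<in> A" "y \<in> B" for x y
    using norm_triangle_ineq[of "u *\<^sub>R x" "v *\<^sub>R y"] that
    by (intro order_trans[OF norm_triangle_ineq] add_mono) (simp_all add: mult_left_mono)
  then show ?thesis unfolding bounded_iff by blast
qed

text \<open>Writing \<open>b + \<rho> z = (1 - \<rho>) b + \<rho> (b + z)\<close> turns an enlargement of \<open>B\<close> into a convex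
  combination; only the part of \<open>B\<close> near \<open>A\<close> is used, so the constant depends on \<open>A\<close> alone.\<close>

lemma mnc_near:
  assumes A: "A \<noteq> {}" "A \<subseteq> cball 0 r" and B: "B \<noteq> {}" "bounded B" and \<rho>: "0 < \<rho>" "\<rho> \<le> 1"
    and near: "\<And>x. x \<in> A \<Longrightarrow> \<exists>y\<in>B. norm (x - y) \<le> \<rho>"
  shows "\<mu> A \<le> \<mu> B + \<rho> * \<mu> (cball 0 (r + 2))"
proof -
  \<comment> \<open>As \<open>\<rho> \<le> 1\<close>, points of \<open>B\<close> within
    \<open>\<rho>\<close> of \<open>A\<close> have norm at most \<open>r + 1\<close>. Adding
    \<open>(x - y) / \<rho>\<close>, of norm at most 1, leads to the radius
    \<open>r + 2\<close>.\<close>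
  define B' where "B' = B \<inter> cball 0 (r + 1)"
  let ?K = "cball 0 (r + 2) :: 'a set"
  let ?S = "{(1 - \<rho>) *\<^sub>R y + (1 - (1 - \<rho>)) *\<^sub>R z | y z. y \<in> B' \<and> z \<in> ?K}"
  have near': "\<exists>y\<in>B'. norm (x - y) \<le> \<rho>" if x: "x \<in> A" for x
  proof -
    obtain y where y: "y \<in> B" "norm (x - y) \<le> \<rho>" using near[OF x] by blast
    have "norm y \<le> norm x + norm (x - y)" using norm_triangle_ineq4[of x "x - y"] by simp
    moreover have "norm x \<le> r" using A(2) x by auto
    ultimately have "y \<in> B'" using y \<rho>(2) by (simp add: B'_def)
    then show ?thesis using y(2) by blast
  qed
  have B': "B' \<noteq> {}" "bounded B'" "B' \<subseteq> B"
    using near' A(1) B(2) by (auto simp only: B'_def bounded_Int)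
  have "0 \<le> r" using A by (metis cball_eq_empty linorder_not_le subset_empty)
  then have K: "?K \<noteq> {}" "bounded ?K" by auto
  have "A \<subseteq> ?S"
  proof
    fix x assume "x \<in> A"
    then obtain y where y: "y \<in> B'" "norm (x - y) \<le> \<rho>" using near' by blast
    define z where "z = y + (1 / \<rho>) *\<^sub>R (x - y)"
    have "norm z \<le> norm y + norm (x - y) / \<rho>"
      unfolding z_def using norm_triangle_ineq[of y "(1 / \<rho>) *\<^sub>R (x - y)"] \<rho> by simp
    also have "\<dots> \<le> (r + 1) + 1"
      using y \<rho> by (intro add_mono) (auto simp: B'_def)
    finally have "z \<in> ?K" by simp
    moreover have "x = (1 - \<rho>) *\<^sub>R y + (1 - (1 - \<rho>)) *\<^sub>R z"
      unfolding z_def using \<rho> by (simp add: algebra_simps)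
    ultimately show "x \<in> ?S" using y(1) by blast
  qed
  then have "\<mu> A \<le> \<mu> ?S"
    using A(1) by (intro mnc_mono bounded_convex_combination B' K)
  also have "\<dots> \<le> (1 - \<rho>) * \<mu> B' + (1 - (1 - \<rho>)) * \<mu> ?K"
    using \<rho> by (intro mnc_convex B' K) auto
  also have "(1 - \<rho>) * \<mu> B' \<le> 1 * \<mu> B"
    using \<rho> B'
    by (intro mult_mono mnc_mono mnc_nonneg B) auto
  finally show ?thesis by simp
qed

text \<open>A point of \<open>A\<close> farther than \<open>\<rho>\<close> from the convex hull of
  \<open>B\<close> could be separated from it by a gap of \<open>\<rho>\<close>, against the strict
  inequality in \<open>near\<close>. Passing to the hull does not change
  \<open>\<mu> B\<close>.\<close>

lemma mnc_near_functionals: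
  assumes A: "A \<noteq> {}" "A \<subseteq> cball 0 r" and B: "B \<noteq> {}" "bounded B" and \<rho>: "0 < \<rho>" "\<rho> \<le> 1"
    and near: "\<And>x f::'a \<Rightarrow>\<^sub>L real. x \<in> A \<Longrightarrow> norm f \<le> 1 \<Longrightarrow>
        \<exists>y\<in>B. blinfun_apply f x < blinfun_apply f y + \<rho>"
  shows "\<mu> A \<le> \<mu> B + \<rho> * \<mu> (cball 0 (r + 2))"
proof -
  have "\<mu> A \<le> \<mu> (convex hull B) + \<rho> * \<mu> (cball 0 (r + 2))"
  proof (rule mnc_near[OF A _ _ \<rho>])
    show "convex hull B \<noteq> {}" "bounded (convex hull B)"
      using B bounded_convex_hull by auto
    fix x assume x: "x \<in> A"
    show "\<exists>y\<in>convex hull B. norm (x - y) \<le> \<rho>"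
    proof (rule ccontr)
      assume "\<not> ?thesis"
      then have "\<rho> \<le> norm (x - y)" if "y \<in> convex hull B" for y using that by force
      then obtain f :: "'a \<Rightarrow>\<^sub>L real"
        where f: "norm f \<le> 1" "\<forall>y\<in>convex hull B. blinfun_apply f y + \<rho> \<le> blinfun_apply f x"
        using convex_separation[of "convex hull B" \<rho> x] B by auto
      then show False using near[OF x f(1)] hull_subset[of B convex] by force
    qed
  qed
  then show ?thesis using mnc_convex_hull[OF B] by simp
qed

text \<open>Weights of total below 1 are allowed because the missing mass falls on the empty sum
  \<open>{0}\<close>, where \<open>\<mu>\<close> vanishes. Boundedness is carried through the
  induction since the convexity axiom requires it.\<close>

lemma mnc_subconvex_sum:
  fixes A :: "'i \<Rightarrow> 'a set"
  assumes "finite I" "\<And>i. i \<in> I \<Longrightarrow> A i \<noteq> {}" "\<And>i. i \<in> I \<Longrightarrow> bounded (A i)"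
    "\<And>i. i \<in> I \<Longrightarrow> 0 \<le> w i" "sum w I \<le> 1"
  shows "bounded {\<Sum>i\<in>I. w i *\<^sub>R x i | x. \<forall>i\<in>I. x i \<in> A i} \<and>
    \<mu> {\<Sum>i\<in>I. w i *\<^sub>R x i | x. \<forall>i\<in>I. x i \<in> A i} \<le> (\<Sum>i\<in>I. w i * \<mu> (A i))"
  using assms
proof (induction I arbitrary: w rule: finite_induct)
  case empty
  then show ?case by (simp add: mnc_singleton)
next
  case (insert j I)
  let ?S = "\<lambda>w I. {\<Sum>i\<in>I. w i *\<^sub>R x i | x. \<forall>i\<in>I. x i \<in> A i}"
  define c where "c = 1 - w j"
  have sum: "w j + sum w I \<le> 1" using insert by simp
  have wI: "0 \<le> sum w I" using insert.prems(3) by (intro sum_nonneg) auto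
  have c0: "0 \<le> c" "c \<le> 1" "sum w I \<le> c" using sum wI insert.prems(3) by (auto simp: c_def)
  \<comment> \<open>Renormalised weights. For \<open>c = 0\<close> the quotient is 0 by convention,
    which is harmless: then every remaining \<open>w i\<close> is 0 as well.\<close>
  define v where "v = (\<lambda>i. w i / c)"
  have wv: "w i = c * v i" if "i \<in> I" for i
  proof (cases "c = 0")
    case True
    then have "sum w I = 0" using c0 wI by simp
    then have "w i = 0" using that insert.prems(3) insert.hyps(1) sum_nonneg_eq_0_iff[of I w] by auto
    then show ?thesis using True by simp
  qed (simp add: v_def)
  have "sum v I \<le> 1"
    using c0 by (cases "c = 0") (auto simp: v_def sum_divide_distrib[symmetric] divide_le_eq)
  moreover have "0 \<le> v i" if "i \<in> I" for i
    using insert.prems(3) that c0 by (auto simp: v_def)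
  ultimately have IH: "bounded (?S v I)" "\<mu> (?S v I) \<le> (\<Sum>i\<in>I. v i * \<mu> (A i))"
    using insert.IH[of v] insert.prems(1,2) by auto
  let ?T = "{w j *\<^sub>R x + (1 - w j) *\<^sub>R y | x y. x \<in> A j \<and> y \<in> ?S v I}"
  have split: "(\<Sum>i\<in>insert j I. w i *\<^sub>R x i) = w j *\<^sub>R x j + (1 - w j) *\<^sub>R (\<Sum>i\<in>I. v i *\<^sub>R x i)"
    for x :: "'i \<Rightarrow> 'a"
    using insert.hyps wv by (simp add: c_def[symmetric] scaleR_sum_right)
  have sub: "?S w (insert j I) \<subseteq> ?T"
  proof
    fix z assume "z \<in> ?S w (insert j I)"
    then obtain x where x: "z = (\<Sum>i\<in>insert j I. w i *\<^sub>R x i)" "\<forall>i\<in>insert j I. x i \<in> A i"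
      by (elim CollectE exE conjE)
    have "x j \<in> A j" "(\<Sum>i\<in>I. v i *\<^sub>R x i) \<in> ?S v I" using x(2) by auto
    then show "z \<in> ?T" unfolding x(1) split
      by (intro CollectI exI[of _ "x j"] exI[of _ "\<Sum>i\<in>I. v i *\<^sub>R x i"]) simp
  qed
  have bT: "bounded ?T"
    by (rule bounded_convex_combination) (use insert.prems(2) IH in auto)
  obtain x0 where "\<forall>i\<in>insert j I. x0 i \<in> A i"
    using bchoice[of "insert j I" "\<lambda>i y. y \<in> A i"] insert.prems(1) by (meson equals0I)
  then have ne: "?S w (insert j I) \<noteq> {}" "?S v I \<noteq> {}" by auto
  have "bounded (?S w (insert j I))" using bT sub by (rule bounded_subset)
  moreover have "\<mu> (?S w (insert j I)) \<le> \<mu> ?T" using ne(1) bT sub by (rule mnc_mono)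
  moreover have "\<mu> ?T \<le> w j * \<mu> (A j) + (1 - w j) * \<mu> (?S v I)"
    using insert.prems c0 ne IH(1) by (intro mnc_convex) (auto simp: c_def)
  moreover have "(1 - w j) * \<mu> (?S v I) \<le> c * (\<Sum>i\<in>I. v i * \<mu> (A i))"
    unfolding c_def[symmetric] using IH(2) c0(1) by (rule mult_left_mono)
  moreover have "c * (\<Sum>i\<in>I. v i * \<mu> (A i)) = (\<Sum>i\<in>I. w i * \<mu> (A i))"
    using wv by (simp add: sum_distrib_left mult.assoc)
  ultimately show ?case using insert.hyps by simp
qed

end

section \<open>The Bochner integral\<close>

text \<open>Measurability of limits needs convergence at every point, so \<open>f\<close> is
  exchanged for a function that differs from it on a null set only.\<close>

lemma strongly_measurable_representative:
  fixes f :: "'a \<Rightarrow> 'b::metric_space"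
  assumes "strongly_measurable M f"
  shows "\<exists>s f'. (\<forall>i. simple_function M (s i)) \<and>
    (\<forall>t\<in>space M. (\<lambda>i. s i t) \<longlonglongrightarrow> f' t) \<and> (AE t in M. f' t = f t)"
proof -
  obtain s where s: "\<And>i. simple_function M (s i)" and ae: "AE t in M. (\<lambda>i. s i t) \<longlonglongrightarrow> f t"
    using assms unfolding strongly_measurable_def by blast
  from AE_E[OF ae] obtain N where N: "{t \<in> space M. \<not> (\<lambda>i. s i t) \<longlonglongrightarrow> f t} \<subseteq> N"
    "emeasure M N = 0" "N \<in> sets M" .
  \<comment> \<open>On the exceptional set the sequence is frozen at \<open>s 0\<close>, so that it
    converges there too.\<close>
  define s' where "s' = (\<lambda>i t. if t \<in> N then s 0 t else s i t)"
  define f' where "f' = (\<lambda>t. if t \<in> N then s 0 t else f t)"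
  have "simple_function M (s' i)" for i
    unfolding s'_def using N(3) s by (intro simple_function_If_set) auto
  moreover have "(\<lambda>i. s' i t) \<longlonglongrightarrow> f' t" if "t \<in> space M" for t
    using N(1) that by (auto simp: s'_def f'_def)
  moreover have "AE t in M. f' t = f t"
    by (rule AE_I'[of N]) (use N in \<open>auto simp: f'_def null_sets_def\<close>)
  ultimately show ?thesis by blast
qed

text \<open>In a nonseparable space the difference of Borel maps need not be Borel. The scalar
  function is instead a pointwise limit of simple ones.\<close>

lemma borel_measurable_norm_diff_simple:
  fixes s :: "'a \<Rightarrow> 'b::real_normed_vector"
  assumes "\<And>i. simple_function M (u i)" "simple_function M s"
    and "\<And>t. t \<in> space M \<Longrightarrow> (\<lambda>i. u i t) \<longlonglongrightarrow> f t"
  shows "(\<lambda>t. norm (f t - s t)) \<in> borel_measurable M"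
proof (rule borel_measurable_LIMSEQ_metric)
  show "(\<lambda>t. norm (u i t - s t)) \<in> borel_measurable M" for i
    by (rule borel_measurable_simple_function,
        rule simple_function_compose2[OF assms(1,2), where h = "\<lambda>a b. norm (a - b)"])
  show "(\<lambda>i. norm (u i t - s t)) \<longlonglongrightarrow> norm (f t - s t)" if "t \<in> space M" for t
    by (intro tendsto_intros assms that)
qed

text \<open>The triangle inequality under the integral. Splitting the integral of a sum requires
  measurable summands, which are available for the representative \<open>f'\<close>; replacing
  \<open>f\<close> by it changes no integral.\<close>

lemma simple_bochner_integral_dist_le:
  fixes f :: "'a \<Rightarrow> 'b::real_normed_vector"
  assumes f: "strongly_measurable M f"
    and s: "Bochner_Integration.simple_bochner_integrable M s"
    and t: "Bochner_Integration.simple_bochner_integrable M t"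
  shows "ennreal (dist (Bochner_Integration.simple_bochner_integral M s)
        (Bochner_Integration.simple_bochner_integral M t)) \<le>
    (\<integral>\<^sup>+ x. ennreal (norm (f x - s x)) \<partial>M) + (\<integral>\<^sup>+ x. ennreal (norm (f x - t x)) \<partial>M)"
proof -
  obtain u f' where "\<forall>i. simple_function M (u i)"
    "\<forall>t\<in>space M. (\<lambda>i. u i t) \<longlonglongrightarrow> f' t" and ae: "AE t in M. f' t = f t"
    using strongly_measurable_representative[OF f] by (elim exE conjE)
  then have u: "\<And>i. simple_function M (u i)"
    "\<And>t. t \<in> space M \<Longrightarrow> (\<lambda>i. u i t) \<longlonglongrightarrow> f' t" by simp_all
  have "simple_function M s" "simple_function M t"
    using s t by (auto elim: Bochner_Integration.simple_bochner_integrable.cases)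
  then have [measurable]: "(\<lambda>x. norm (f' x - s x)) \<in> borel_measurable M"
    "(\<lambda>x. norm (f' x - t x)) \<in> borel_measurable M"
    by (simp_all add: borel_measurable_norm_diff_simple[OF u(1) _ u(2)])
  have eq: "(\<integral>\<^sup>+ x. ennreal (norm (f x - v x)) \<partial>M) = (\<integral>\<^sup>+ x. ennreal (norm (f' x - v x)) \<partial>M)" for v
    by (rule nn_integral_cong_AE) (use ae in auto)
  let ?I = "Bochner_Integration.simple_bochner_integral M"
  have "dist (?I s) (?I t) = norm (?I (\<lambda>x. s x - t x))"
    using s t by (simp add: Bochner_Integration.simple_bochner_integral_diff dist_norm)
  also have "\<dots> \<le> ?I (\<lambda>x. norm (s x - t x))"
    using Bochner_Integration.simple_bochner_integrable_compose2[of "(-)" M s t] s t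
    by (auto intro!: Bochner_Integration.simple_bochner_integral_norm_bound)
  finally have "ennreal (dist (?I s) (?I t)) \<le> ennreal (?I (\<lambda>x. norm (s x - t x)))"
    by (rule ennreal_leI)
  also have "\<dots> = (\<integral>\<^sup>+x. norm (s x - t x) \<partial>M)"
    using Bochner_Integration.simple_bochner_integrable_compose2[of "\<lambda>x y. norm (x - y)" M s t] s t
    by (auto intro!: Bochner_Integration.simple_bochner_integral_eq_nn_integral)
  also have "\<dots> \<le> (\<integral>\<^sup>+x. ennreal (norm (f' x - s x)) + ennreal (norm (f' x - t x)) \<partial>M)"
  proof (rule nn_integral_mono)
    fix x
    have "norm (s x - t x) \<le> norm (f' x - s x) + norm (f' x - t x)"
      using norm_triangle_ineq4[of "f' x - t x" "f' x - s x"] by simp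
    then show "ennreal (norm (s x - t x)) \<le> ennreal (norm (f' x - s x)) + ennreal (norm (f' x - t x))"
      by (simp add: ennreal_leI flip: ennreal_plus)
  qed
  also have "\<dots> = (\<integral>\<^sup>+ x. ennreal (norm (f' x - s x)) \<partial>M) + (\<integral>\<^sup>+ x. ennreal (norm (f' x - t x)) \<partial>M)"
    by (rule nn_integral_add) auto
  finally show ?thesis unfolding eq .
qed

text \<open>The integrals of the approximants form a Cauchy sequence, so completeness provides the
  value that the definition asks for.\<close>

lemma bochner_integrable_genI:
  fixes f :: "'a \<Rightarrow> 'b::banach"
  assumes f: "strongly_measurable M f"
    and s: "\<And>i. Bochner_Integration.simple_bochner_integrable M (s i)"
    and lim: "(\<lambda>i. \<integral>\<^sup>+ t. ennreal (norm (f t - s i t)) \<partial>M) \<longlonglongrightarrow> 0"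
  shows "bochner_integrable_gen M f"
proof -
  let ?I = "\<lambda>i. Bochner_Integration.simple_bochner_integral M (s i)"
  have "Cauchy ?I"
  proof (rule metric_CauchyI)
    fix e :: real assume e: "0 < e"
    have "\<forall>\<^sub>F i in sequentially. (\<integral>\<^sup>+ t. ennreal (norm (f t - s i t)) \<partial>M) < ennreal (e / 2)"
      using lim e by (intro order_tendstoD(2)) auto
    then obtain n where n: "\<And>i. n \<le> i \<Longrightarrow>
        (\<integral>\<^sup>+ t. ennreal (norm (f t - s i t)) \<partial>M) < ennreal (e / 2)"
      by (auto simp: eventually_sequentially)
    have "dist (?I i) (?I j) < e" if "n \<le> i" "n \<le> j" for i j
    proof -
      have "ennreal (dist (?I i) (?I j)) < ennreal (e / 2) + ennreal (e / 2)"
        using simple_bochner_integral_dist_le[OF f s s, of i j]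
          add_strict_mono[OF n[OF that(1)] n[OF that(2)]] by (rule le_less_trans)
      then show ?thesis using e by (simp add: ennreal_less_iff flip: ennreal_plus)
    qed
    then show "\<exists>n. \<forall>i\<ge>n. \<forall>j\<ge>n. dist (?I i) (?I j) < e" by blast
  qed
  then obtain x where "?I \<longlonglongrightarrow> x" using Cauchy_convergent convergent_def by blast
  then show ?thesis
    unfolding bochner_integrable_gen_def has_bochner_integral_gen_def using f s lim by blast
qed

section \<open>Restriction to a measurable subset\<close>

lemma simple_function_restrict_spaceI:
  fixes u :: "'a \<Rightarrow> 'b::real_normed_vector"
  assumes u: "simple_function M u" and T: "T \<in> sets M"
  shows "simple_function (restrict_space M T) u"
proof -
  have TM: "T \<inter> space M \<in> sets M" using T by auto
  have "simple_function M (\<lambda>x. indicator T x *\<^sub>R u x)"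
    using simple_function_compose2[OF simple_function_indicator[OF T] u,
        of "\<lambda>a b. a *\<^sub>R b"] by simp
  then show ?thesis using simple_function_restrict_space[OF TM] by blast
qed

lemma strongly_measurable_restrict_space:
  fixes f :: "'a \<Rightarrow> 'b::real_normed_vector"
  assumes f: "strongly_measurable M f" and T: "T \<in> sets M"
  shows "strongly_measurable (restrict_space M T) f"
proof -
  have TM: "T \<inter> space M \<in> sets M" using T by auto
  obtain u where u: "\<And>i. simple_function M (u i)" "AE t in M. (\<lambda>i. u i t) \<longlonglongrightarrow> f t"
    using f unfolding strongly_measurable_def by blast
  have "AE t in restrict_space M T. (\<lambda>i. u i t) \<longlonglongrightarrow> f t"
    using u(2) by (simp add: AE_restrict_space_iff[OF TM] eventually_mono)
  then show ?thesis
    unfolding strongly_measurable_def using simple_function_restrict_spaceI[OF u(1) T] by blast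
qed

text \<open>The approximants of \<open>f\<close> remain valid, since restriction only decreases
  their errors. The new integral has another value, whose existence comes from
  \<open>bochner_integrable_genI\<close>.\<close>

lemma bochner_integrable_gen_restrict_space:
  fixes f :: "'a \<Rightarrow> 'b::banach"
  assumes f: "bochner_integrable_gen M f" and T: "T \<in> sets M"
  shows "bochner_integrable_gen (restrict_space M T) f"
proof -
  have TM: "T \<inter> space M \<in> sets M" using T by auto
  obtain x where "has_bochner_integral_gen M f x"
    using f unfolding bochner_integrable_gen_def by blast
  then obtain s where sm: "strongly_measurable M f"
    and s: "\<And>i. Bochner_Integration.simple_bochner_integrable M (s i)"
    and lim: "(\<lambda>i. \<integral>\<^sup>+ t. ennreal (norm (f t - s i t)) \<partial>M) \<longlonglongrightarrow> 0"
    unfolding has_bochner_integral_gen_def by blast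
  have "strongly_measurable (restrict_space M T) f"
    using sm T by (rule strongly_measurable_restrict_space)
  moreover have "Bochner_Integration.simple_bochner_integrable (restrict_space M T) (s i)" for i
  proof (rule Bochner_Integration.simple_bochner_integrable.intros)
    have si: "simple_function M (s i)" "emeasure M {y \<in> space M. s i y \<noteq> 0} \<noteq> \<infinity>"
      using s[of i] by (auto elim: Bochner_Integration.simple_bochner_integrable.cases)
    show "simple_function (restrict_space M T) (s i)"
      using si(1) T by (rule simple_function_restrict_spaceI)
    have "{y \<in> space M. s i y \<noteq> 0} = s i -` (- {0}) \<inter> space M" by auto
    then have "{y \<in> space M. s i y \<noteq> 0} \<in> sets M"
      using simple_functionD(2)[OF si(1), of "- {0}"] by simp
    then have "emeasure M {y \<in> space (restrict_space M T). s i y \<noteq> 0}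
        \<le> emeasure M {y \<in> space M. s i y \<noteq> 0}"
      by (intro emeasure_mono) (auto simp: space_restrict_space)
    then show "emeasure (restrict_space M T) {y \<in> space (restrict_space M T). s i y \<noteq> 0} \<noteq> \<infinity>"
      using si(2) by (subst emeasure_restrict_space[OF TM])
        (auto simp: space_restrict_space top_unique)
  qed
  moreover have "(\<lambda>i. \<integral>\<^sup>+ t. ennreal (norm (f t - s i t)) \<partial>restrict_space M T) \<longlonglongrightarrow> 0"
  proof (rule tendsto_sandwich[OF _ _ tendsto_const lim])
    show "\<forall>\<^sub>F i in sequentially. (\<integral>\<^sup>+ t. ennreal (norm (f t - s i t)) \<partial>restrict_space M T)
        \<le> (\<integral>\<^sup>+ t. ennreal (norm (f t - s i t)) \<partial>M)"
      by (intro always_eventually allI, subst nn_integral_restrict_space[OF TM],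
          intro nn_integral_mono) (simp split: split_indicator)
  qed simp
  ultimately show ?thesis by (rule bochner_integrable_genI)
qed

text \<open>A functional commutes with the integral of simple functions and, having norm at most
  one, does not increase the approximation error. The detour through \<open>h\<close> is due to null
  sets: \<open>f\<close> is a limit of simple functions only almost everywhere, and \<open>M\<close>
  need not be complete.\<close>

lemma has_bochner_integral_gen_functional:
  fixes f :: "'a \<Rightarrow> 'b::real_normed_vector" and \<phi> :: "'b \<Rightarrow>\<^sub>L real"
  assumes f: "has_bochner_integral_gen M f x" and \<phi>: "norm \<phi> \<le> 1"
  obtains h where "has_bochner_integral M h (blinfun_apply \<phi> x)"
    "AE t in M. h t = blinfun_apply \<phi> (f t)"
proof -
  obtain s where sm: "strongly_measurable M f"
    and s: "\<And>i. Bochner_Integration.simple_bochner_integrable M (s i)"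
    and lim: "(\<lambda>i. \<integral>\<^sup>+ t. ennreal (norm (f t - s i t)) \<partial>M) \<longlonglongrightarrow> 0"
    and limx: "(\<lambda>i. Bochner_Integration.simple_bochner_integral M (s i)) \<longlonglongrightarrow> x"
    using f unfolding has_bochner_integral_gen_def by blast
  obtain u f' where "\<forall>i. simple_function M (u i)"
    "\<forall>t\<in>space M. (\<lambda>i. u i t) \<longlonglongrightarrow> f' t" and ae: "AE t in M. f' t = f t"
    using strongly_measurable_representative[OF sm] by (elim exE conjE)
  then have u: "\<And>i. simple_function M (u i)"
    "\<And>t. t \<in> space M \<Longrightarrow> (\<lambda>i. u i t) \<longlonglongrightarrow> f' t" by simp_all
  have "has_bochner_integral M (\<lambda>t. blinfun_apply \<phi> (f' t)) (blinfun_apply \<phi> x)"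
  proof (rule Bochner_Integration.has_bochner_integral.intros)
    show "(\<lambda>t. blinfun_apply \<phi> (f' t)) \<in> borel_measurable M"
    proof (rule borel_measurable_LIMSEQ_metric)
      show "(\<lambda>t. blinfun_apply \<phi> (u i t)) \<in> borel_measurable M" for i
        by (rule borel_measurable_simple_function, rule simple_function_compose1[OF u(1)])
      show "(\<lambda>i. blinfun_apply \<phi> (u i t)) \<longlonglongrightarrow> blinfun_apply \<phi> (f' t)" if "t \<in> space M" for t
        by (intro tendsto_intros u(2) that)
    qed
    show "Bochner_Integration.simple_bochner_integrable M (\<lambda>t. blinfun_apply \<phi> (s i t))" for i
      using Bochner_Integration.simple_bochner_integrable_compose2[of "\<lambda>x y. blinfun_apply \<phi> x",
          OF _ s s] by simp
    have le: "(\<integral>\<^sup>+ t. ennreal (norm (blinfun_apply \<phi> (f' t) - blinfun_apply \<phi> (s i t))) \<partial>M)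
        \<le> (\<integral>\<^sup>+ t. ennreal (norm (f t - s i t)) \<partial>M)" for i
    proof (rule nn_integral_mono_AE, use ae in eventually_elim)
      fix t assume eq: "f' t = f t"
      have "norm (blinfun_apply \<phi> (f t - s i t)) \<le> norm \<phi> * norm (f t - s i t)"
        by (rule norm_blinfun)
      also have "\<dots> \<le> 1 * norm (f t - s i t)"
        using \<phi> by (rule mult_right_mono) simp
      finally show "ennreal (norm (blinfun_apply \<phi> (f' t) - blinfun_apply \<phi> (s i t)))
          \<le> ennreal (norm (f t - s i t))"
        by (simp add: eq blinfun.diff_right ennreal_leI)
    qed
    show "(\<lambda>i. \<integral>\<^sup>+ t. ennreal (norm (blinfun_apply \<phi> (f' t) - blinfun_apply \<phi> (s i t))) \<partial>M) \<longlonglongrightarrow> 0"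
      by (rule tendsto_sandwich[OF _ _ tendsto_const lim]) (use le in auto)
    have "linear (blinfun_apply \<phi>)"
      by (simp add: blinfun.bounded_linear_right bounded_linear.linear)
    then have eq: "Bochner_Integration.simple_bochner_integral M (\<lambda>t. blinfun_apply \<phi> (s i t))
        = blinfun_apply \<phi> (Bochner_Integration.simple_bochner_integral M (s i))" for i
      using s by (rule Bochner_Integration.simple_bochner_integral_linear)
    show "(\<lambda>i. Bochner_Integration.simple_bochner_integral M (\<lambda>t. blinfun_apply \<phi> (s i t)))
        \<longlonglongrightarrow> blinfun_apply \<phi> x"
      unfolding eq by (intro tendsto_intros limx)
  qed
  moreover have "AE t in M. blinfun_apply \<phi> (f' t) = blinfun_apply \<phi> (f t)"
    using ae by eventually_elim simp
  ultimately show thesis by (rule that)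
qed

text \<open>Uniqueness of scalar integrals suffices because functionals determine the norm. This
  justifies the \<open>THE\<close> in \<open>bochner_integral_gen\<close>.\<close>

lemma has_bochner_integral_gen_unique:
  assumes "has_bochner_integral_gen M f x" "has_bochner_integral_gen M f y"
  shows "x = y"
proof -
  have "norm (x - y) \<le> 0"
  proof (rule norm_le_if_functionals_le)
    fix \<phi> :: "'b \<Rightarrow>\<^sub>L real" assume \<phi>: "norm \<phi> \<le> 1"
    obtain h where h: "has_bochner_integral M h (blinfun_apply \<phi> x)"
      "AE t in M. h t = blinfun_apply \<phi> (f t)"
      using has_bochner_integral_gen_functional[OF assms(1) \<phi>] .
    obtain k where k: "has_bochner_integral M k (blinfun_apply \<phi> y)"
      "AE t in M. k t = blinfun_apply \<phi> (f t)"
      using has_bochner_integral_gen_functional[OF assms(2) \<phi>] .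
    have "AE t in M. h t = k t" using h(2) k(2) by eventually_elim simp
    then have "blinfun_apply \<phi> x = blinfun_apply \<phi> y"
      by (rule Bochner_Integration.has_bochner_integral_eq_AE[OF h(1) k(1)])
    then show "blinfun_apply \<phi> (x - y) \<le> 0" by (simp add: blinfun.diff_right)
  qed
  then show ?thesis by simp
qed

lemma has_bochner_integral_gen_bochner_integral_gen:
  assumes "bochner_integrable_gen M f"
  shows "has_bochner_integral_gen M f (bochner_integral_gen M f)"
proof -
  obtain x where x: "has_bochner_integral_gen M f x"
    using assms unfolding bochner_integrable_gen_def by blast
  then have "(THE x. has_bochner_integral_gen M f x) = x"
    using has_bochner_integral_gen_unique by blast
  then show ?thesis using assms x by (simp add: bochner_integral_gen_def)
qed

section \<open>The support functional of a family\<close>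

lemma apply_J_fun_Dual_ball:
  fixes G :: "('t \<Rightarrow> 'a::real_normed_vector) set"
  assumes "G \<noteq> {}" "\<forall>g\<in>G. norm (g t) \<le> C" "norm f \<le> 1"
  shows "apply_bcontfun (J_fun G t) (Dual_ball f) = (SUP g\<in>G. blinfun_apply f (g t))"
proof -
  have "functional (Dual_ball f) = f" using assms(3) by (simp add: Dual_ball_inverse)
  then show ?thesis
    using apply_J_fun[of G t C "Dual_ball f", OF assms(1)] assms(2) by simp
qed

lemma functional_le_J_fun:
  fixes G :: "('t \<Rightarrow> 'a::real_normed_vector) set"
  assumes g: "g \<in> G" and C: "\<forall>g\<in>G. norm (g t) \<le> C" and f: "norm f \<le> 1"
  shows "blinfun_apply f (g t) \<le> apply_bcontfun (J_fun G t) (Dual_ball f)"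
proof -
  have "G \<noteq> {}" using g by auto
  have "bdd_above ((\<lambda>g. blinfun_apply f (g t)) ` G)"
  proof (rule bdd_aboveI2)
    fix k assume "k \<in> G"
    have "\<bar>blinfun_apply f (k t)\<bar> \<le> norm f * norm (k t)"
      using norm_blinfun[of f "k t"] by simp
    also have "\<dots> \<le> 1 * C"
      using C \<open>k \<in> G\<close> f by (intro mult_mono) auto
    finally show "blinfun_apply f (k t) \<le> C" by simp
  qed
  then show ?thesis
    unfolding apply_J_fun_Dual_ball[OF \<open>G \<noteq> {}\<close> C f] by (intro cSUP_upper g)
qed

lemma less_J_funD:
  fixes G :: "('t \<Rightarrow> 'a::real_normed_vector) set"
  assumes G: "G \<noteq> {}" and C: "\<forall>g\<in>G. norm (g t) \<le> C" and f: "norm f \<le> 1"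
    and c: "c < apply_bcontfun (J_fun G t) (Dual_ball f)"
  shows "\<exists>g\<in>G. c < blinfun_apply f (g t)"
proof (rule ccontr)
  assume "\<not> ?thesis"
  then have "(SUP g\<in>G. blinfun_apply f (g t)) \<le> c"
    by (intro cSUP_least[OF G]) auto
  then show False using c unfolding apply_J_fun_Dual_ball[OF G C f] by simp
qed

text \<open>Sup-norm closeness of the support functionals is the functional-wise closeness required
  above. The error involves the radius \<open>r\<close> at \<open>s\<close> but not
  \<open>r'\<close>, so it stays fixed while \<open>t\<close> varies.\<close>

lemma mnc_J_fun_near:
  fixes G :: "('t \<Rightarrow> 'a::real_normed_vector) set"
  assumes \<mu>: "convex_mnc \<mu>" and G: "G \<noteq> {}"
    and s: "\<forall>g\<in>G. norm (g s) \<le> r" and t: "\<forall>g\<in>G. norm (g t) \<le> r'"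
    and \<rho>: "0 < \<rho>" "\<rho> \<le> 1" and d: "dist (J_fun G s) (J_fun G t) < \<rho>"
  shows "\<mu> {g s | g. g \<in> G} \<le> \<mu> {g t | g. g \<in> G} + \<rho> * \<mu> (cball 0 (r + 2))"
proof (rule mnc_near_functionals[OF \<mu> _ _ _ _ \<rho>])
  show "{g s | g. g \<in> G} \<noteq> {}" "{g t | g. g \<in> G} \<noteq> {}" using G by auto
  show "{g s | g. g \<in> G} \<subseteq> cball 0 r" using s by auto
  show "bounded {g t | g. g \<in> G}" unfolding bounded_iff using t by auto
  fix x and f :: "'a \<Rightarrow>\<^sub>L real" assume "x \<in> {g s | g. g \<in> G}" and f: "norm f \<le> 1"
  then obtain g where g: "g \<in> G" "x = g s" by auto
  have "blinfun_apply f x \<le> apply_bcontfun (J_fun G s) (Dual_ball f)"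
    unfolding g(2) using functional_le_J_fun[OF g(1) s f] .
  also have "\<dots> < apply_bcontfun (J_fun G t) (Dual_ball f) + \<rho>"
    using dist_fun_lt_imp_dist_val_lt[OF d, of "Dual_ball f"] unfolding dist_real_def by linarith
  finally have "blinfun_apply f x - \<rho> < apply_bcontfun (J_fun G t) (Dual_ball f)" by simp
  then have "\<exists>k\<in>G. blinfun_apply f x - \<rho> < blinfun_apply f (k t)"
    by (rule less_J_funD[OF G t f])
  then obtain k where "k \<in> G" "blinfun_apply f x - \<rho> < blinfun_apply f (k t)"
    by (rule bexE)
  then show "\<exists>y\<in>{g t | g. g \<in> G}. blinfun_apply f x < blinfun_apply f y + \<rho>"
    by (intro bexI[of _ "k t"]) auto
qed

lemma borel_measurable_lsc_compose:
  fixes F :: "'a \<Rightarrow> 'b::metric_space" and m :: "'a \<Rightarrow> real"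
  assumes F: "F \<in> borel_measurable M" and D: "D \<in> sets M"
    and lsc: "\<And>s c. s \<in> D \<Longrightarrow> c < m s \<Longrightarrow>
        \<exists>d>0. \<forall>t\<in>D. dist (F s) (F t) < d \<longrightarrow> c < m t"
  shows "m \<in> borel_measurable (restrict_space M D)"
  unfolding borel_measurable_iff_greater
proof
  fix c
  \<comment> \<open>The largest open set whose preimage forces \<open>m\<close> above
    \<open>c\<close>; taking the union of all candidates avoids a choice of radii.\<close>
  define V where "V = \<Union>{B. open B \<and> (\<forall>t\<in>D. F t \<in> B \<longrightarrow> c < m t)}"
  have "open V" unfolding V_def by (rule open_Union) simp
  then have "F -` V \<inter> space M \<in> sets M"
    by (intro measurable_sets[OF F] borel_open)
  moreover have "{t \<in> D. c < m t} = (F -` V \<inter> space M) \<inter> D"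
  proof (intro equalityI subsetI)
    fix s assume "s \<in> {t \<in> D. c < m t}"
    then have s: "s \<in> D" "c < m s" by simp_all
    then obtain d where d: "0 < d" "\<forall>t\<in>D. dist (F s) (F t) < d \<longrightarrow> c < m t"
      using lsc by blast
    have "ball (F s) d \<in> {B. open B \<and> (\<forall>t\<in>D. F t \<in> B \<longrightarrow> c < m t)}"
      using d(2) by (simp add: mem_ball)
    moreover have "F s \<in> ball (F s) d" using d(1) by simp
    ultimately have "F s \<in> V" unfolding V_def by (rule UnionI)
    then show "s \<in> (F -` V \<inter> space M) \<inter> D"
      using s(1) sets.sets_into_space[OF D] by auto
  next
    fix t assume "t \<in> (F -` V \<inter> space M) \<inter> D"
    then have "F t \<in> V" "t \<in> D" by simp_all
    then show "t \<in> {t \<in> D. c < m t}" unfolding V_def by (elim UnionE) simp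
  qed
  ultimately have "{t \<in> D. c < m t} \<in> sets M" using D by auto
  moreover have "D \<inter> space M = D" using sets.sets_into_space[OF D] by auto
  ultimately show "{t \<in> space (restrict_space M D). c < m t} \<in> sets (restrict_space M D)"
    using D by (simp add: space_restrict_space sets_restrict_space_iff)
qed

lemma borel_measurable_mnc_family:
  fixes G :: "(real \<Rightarrow> 'a::real_normed_vector) set"
  assumes \<mu>: "convex_mnc \<mu>" and G: "G \<noteq> {}" and S: "S \<in> sets lebesgue"
    and bd: "AE t in lebesgue_on S. \<forall>g\<in>G. norm (g t) \<le> \<psi> t"
    and J: "strongly_measurable (lebesgue_on S) (J_fun G)"
  shows "(\<lambda>t. \<mu> {g t | g. g \<in> G}) \<in> borel_measurable (lebesgue_on S)"
proof -
  let ?M = "lebesgue_on S" and ?m = "\<lambda>t. \<mu> {g t | g. g \<in> G}"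
  obtain u F where "\<forall>i. simple_function ?M (u i)" "\<forall>t\<in>space ?M. (\<lambda>i. u i t) \<longlonglongrightarrow> F t"
    and ae: "AE t in ?M. F t = J_fun G t"
    using strongly_measurable_representative[OF J] by (elim exE conjE)
  then have F: "F \<in> borel_measurable ?M"
    by (intro borel_measurable_LIMSEQ_metric[of u ?M F] borel_measurable_simple_function) simp_all
  have "AE t in ?M. F t = J_fun G t \<and> (\<forall>g\<in>G. norm (g t) \<le> \<psi> t)"
    using ae bd by eventually_elim simp
  from AE_E[OF this] obtain N where
    N: "{t \<in> space ?M. \<not> (F t = J_fun G t \<and> (\<forall>g\<in>G. norm (g t) \<le> \<psi> t))} \<subseteq> N"
    "emeasure ?M N = 0" "N \<in> sets ?M" .
  have N0: "N \<in> null_sets ?M" using N by (simp add: null_sets_def)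
  define D where "D = S - N"
  have D: "D \<in> sets ?M" using N(3) sets.compl_sets[of N ?M] by (simp add: D_def)
  have DF: "F t = J_fun G t" and Db: "\<forall>g\<in>G. norm (g t) \<le> \<psi> t" if "t \<in> D" for t
    using that N(1) by (auto simp: D_def)
  have "?m \<in> borel_measurable (restrict_space ?M D)"
  proof (rule borel_measurable_lsc_compose[OF F D])
    fix s c assume s: "s \<in> D" and c: "c < ?m s"
    let ?L = "\<mu> (cball 0 (\<psi> s + 2))"
    obtain g where "g \<in> G" using G by auto
    then have "0 \<le> \<psi> s" using bspec[OF Db[OF s], of g] norm_ge_zero[of "g s"] by linarith
    then have L: "0 \<le> ?L" by (intro mnc_nonneg[OF \<mu>]) auto
    \<comment> \<open>The minimum with 1 meets the bound on \<open>\<rho>\<close>; the summand 1 in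
      the denominator covers \<open>?L = 0\<close> and makes \<open>d * ?L < ?m s - c\<close>
      strict.\<close>
    define d where "d = min 1 ((?m s - c) / (?L + 1))"
    have d: "0 < d" "d \<le> 1" using c L by (auto simp: d_def)
    have "d * ?L \<le> (?m s - c) / (?L + 1) * ?L"
      using L by (intro mult_right_mono) (auto simp: d_def)
    also have "\<dots> < ?m s - c" using c L by (simp add: field_simps)
    finally have dL: "d * ?L < ?m s - c" .
    have "c < ?m t" if "t \<in> D" "dist (F s) (F t) < d" for t
    proof -
      have "?m s \<le> ?m t + d * ?L"
        using mnc_J_fun_near[OF \<mu> G Db[OF s] Db[OF that(1)] d]
          that(2)[unfolded DF[OF s] DF[OF that(1)]] by simp
      then show ?thesis using dL by simp
    qed
    then show "\<exists>d>0. \<forall>t\<in>D. dist (F s) (F t) < d \<longrightarrow> c < ?m t" using d(1) by blast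
  qed
  \<comment> \<open>Completeness of Lebesgue measure now restores the null set \<open>N\<close>,
    where nothing is known about the values of \<open>\<mu>\<close>.\<close>
  also have "restrict_space ?M D = lebesgue_on (S - N)"
  proof -
    have "S \<inter> D = S - N" "D \<in> sets lebesgue"
      using D S by (auto simp: D_def sets_restrict_space_iff)
    then show ?thesis using S by (simp add: restrict_restrict_space)
  qed
  finally show ?thesis using borel_measurable_diff_null[OF N0 S] by blast
qed

section \<open>The integral inequality\<close>

text \<open>A limit of simple functions has separable range, so countably many small balls cover it
  and their preimages can be made disjoint. The property \<open>P\<close> is made to hold at every
  point of the pieces, because sample points will be picked from them.\<close>

lemma strongly_measurable_partition:
  fixes J :: "'a \<Rightarrow> 'b::metric_space"
  assumes J: "strongly_measurable M J" and P: "AE t in M. P t" and \<epsilon>: "0 < \<epsilon>"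
  shows "\<exists>E::nat \<Rightarrow> 'a set. range E \<subseteq> sets M \<and> disjoint_family E \<and>
    space M - (\<Union>i. E i) \<in> null_sets M \<and> (\<forall>i. \<forall>s\<in>E i. P s) \<and>
    (\<forall>i. \<forall>s\<in>E i. \<forall>t\<in>E i. dist (J s) (J t) < \<epsilon>)"
proof -
  obtain u F where u: "\<forall>i. simple_function M (u i)" "\<forall>t\<in>space M. (\<lambda>i. u i t) \<longlonglongrightarrow> F t"
    and ae: "AE t in M. F t = J t"
    using strongly_measurable_representative[OF J] by (elim exE conjE)
  then have F: "F \<in> borel_measurable M"
    by (intro borel_measurable_LIMSEQ_metric[of u M F] borel_measurable_simple_function) simp_all
  have "AE t in M. F t = J t \<and> P t"
    using ae P by eventually_elim simp
  from AE_E[OF this] obtain N where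
    N: "{t \<in> space M. \<not> (F t = J t \<and> P t)} \<subseteq> N" "emeasure M N = 0" "N \<in> sets M" .
  define D where "D = space M - N"
  have D: "D \<in> sets M" using N(3) by (simp add: D_def sets.compl_sets)
  have good: "F t = J t" "P t" if "t \<in> D" for t
    using that N(1) by (auto simp: D_def)
  \<comment> \<open>Countable, as each simple function takes finitely many values, and its closure
    contains the range of \<open>F\<close>.\<close>
  define Q where "Q = (\<Union>i. u i ` space M)"
  have Q: "countable Q"
    unfolding Q_def
  proof (rule countable_UN)
    fix i
    have "finite (u i ` space M)" using u(1) by (simp add: simple_functionD(1))
    then show "countable (u i ` space M)" by (rule countable_finite)
  qed simp
  define B where "B = (\<lambda>n. (F -` ball (from_nat_into Q n) (\<epsilon> / 2) \<inter> space M) \<inter> D)"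
  have B: "B n \<in> sets M" for n
    unfolding B_def by (intro sets.Int measurable_sets[OF F] D) simp
  have UB: "(\<Union>n. B n) = D"
  proof (intro equalityI subsetI)
    fix t assume t: "t \<in> D"
    then have tM: "t \<in> space M" by (simp add: D_def)
    then have "(\<lambda>i. u i t) \<longlonglongrightarrow> F t" using u(2) by simp
    then obtain i where "dist (u i t) (F t) < \<epsilon> / 2"
      using metric_LIMSEQ_D[of "\<lambda>i. u i t" "F t" "\<epsilon> / 2"] \<epsilon> by auto
    moreover have "u i t \<in> Q" using tM by (auto simp: Q_def)
    then obtain n where "from_nat_into Q n = u i t" using from_nat_into_surj[OF Q] by blast
    ultimately have "t \<in> B n" using t tM by (simp add: B_def)
    then show "t \<in> (\<Union>n. B n)" by (rule UN_I[OF UNIV_I])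
  qed (auto simp: B_def)
  define E where "E = disjointed B"
  have EB: "E i \<subseteq> B i" for i unfolding E_def by (rule disjointed_subset)
  have UE: "(\<Union>i. E i) = D" unfolding E_def UN_disjointed_eq UB ..
  have "range E \<subseteq> sets M"
    unfolding E_def by (rule sets.range_disjointed_sets) (use B in auto)
  moreover have "disjoint_family E"
    unfolding E_def by (rule disjoint_family_disjointed)
  moreover have "space M - (\<Union>i. E i) \<in> null_sets M"
  proof -
    have "space M - D = N" using sets.sets_into_space[OF N(3)] by (auto simp: D_def)
    then show ?thesis unfolding UE using N(2,3) by (simp add: null_sets_def)
  qed
  moreover have "\<forall>i. \<forall>s\<in>E i. P s"
    using good(2) UE by blast
  moreover have "dist (J s) (J t) < \<epsilon>" if "s \<in> E i" "t \<in> E i" for i s t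
  proof -
    have st: "s \<in> B i" "t \<in> B i" using EB that by auto
    have "dist (F s) (F t) < \<epsilon>"
      by (rule dist_triangle_half_r[of "from_nat_into Q i"]) (use st in \<open>simp_all add: B_def\<close>)
    moreover have "s \<in> D" "t \<in> D" using st by (simp_all add: B_def)
    ultimately show ?thesis using good(1) by simp
  qed
  ultimately show ?thesis by (intro exI[of _ E]) simp
qed

text \<open>Almost every point lies in some piece and so eventually leaves the remainder; dominated
  convergence with majorant \<open>norm (\<psi> t)\<close> does the rest.\<close>

lemma integral_partition_tail:
  fixes \<psi> :: "'a \<Rightarrow> real"
  assumes \<psi>: "integrable M \<psi>" and E: "range E \<subseteq> sets M"
    and null: "space M - (\<Union>i. E i) \<in> null_sets M" and \<eta>: "0 < \<eta>"
  shows "\<exists>n::nat. (\<integral>t. indicator (space M - (\<Union>i<n. E i)) t * \<psi> t \<partial>M) < \<eta>"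
proof -
  have Es[measurable]: "E i \<in> sets M" for i using E by auto
  have [measurable]: "\<psi> \<in> borel_measurable M" using \<psi> by (rule borel_measurable_integrable)
  have "(\<lambda>n. \<integral>t. indicator (space M - (\<Union>i<n. E i)) t * \<psi> t \<partial>M) \<longlonglongrightarrow> (\<integral>t. 0 \<partial>M)"
  proof (rule integral_dominated_convergence[where w = "\<lambda>t. norm (\<psi> t)"])
    show "integrable M (\<lambda>t. norm (\<psi> t))" using \<psi> by (rule integrable_norm)
    have "AE t in M. t \<notin> space M - (\<Union>i. E i)" using null by (rule AE_not_in)
    then show "AE t in M. (\<lambda>n. indicator (space M - (\<Union>i<n. E i)) t * \<psi> t) \<longlonglongrightarrow> 0"
      using AE_space
    proof eventually_elim
      fix t assume "t \<notin> space M - (\<Union>i. E i)" "t \<in> space M"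
      then obtain k where k: "t \<in> E k" by auto
      have "\<forall>\<^sub>F n in sequentially. indicator (space M - (\<Union>i<n. E i)) t * \<psi> t = 0"
        using eventually_gt_at_top[of k] by eventually_elim (use k in \<open>auto simp: indicator_def\<close>)
      then show "(\<lambda>n. indicator (space M - (\<Union>i<n. E i)) t * \<psi> t) \<longlonglongrightarrow> 0"
        by (rule tendsto_eventually)
    qed
    show "AE t in M. norm (indicator (space M - (\<Union>i<n. E i)) t * \<psi> t) \<le> norm (\<psi> t)" for n
      by (rule AE_I2) (simp add: indicator_def)
  qed measurable
  then have "\<forall>\<^sub>F n in sequentially. (\<integral>t. indicator (space M - (\<Union>i<n. E i)) t * \<psi> t \<partial>M) < \<eta>"
    using \<eta> by (intro order_tendstoD(2)) simp_all
  then show ?thesis by (auto simp: eventually_sequentially)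
qed


text \<open>On a partition into sets \<open>E i\<close> where \<open>J_fun G\<close> hardly varies, the integrals lie, up to a
  small error, in the convex hull of \<open>\<Sum>i\<in>I. (|E i| / T) (T G(\<sigma> i))\<close>.  Choosing each \<open>\<sigma> i\<close> to
  nearly minimise \<open>\<mu> (T G(s))\<close> over \<open>E i\<close> makes the Riemann sum a lower sum of the integral.\<close>

lemma mnc_bochner_integral_approx:
  fixes G :: "('t \<Rightarrow> 'a::banach) set"
  assumes \<mu>: "convex_mnc \<mu>" and fin: "finite_measure M" and T: "T = measure M (space M)" "0 < T"
    and G: "G \<noteq> {}" and int: "\<And>g. g \<in> G \<Longrightarrow> bochner_integrable_gen M g"
    and \<psi>: "integrable M \<psi>" and bd: "AE t in M. \<forall>g\<in>G. norm (g t) \<le> \<psi> t"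
    and J: "strongly_measurable M (J_fun G)" and \<delta>: "0 < \<delta>" "\<delta> \<le> 1"
  shows "ennreal (\<mu> {bochner_integral_gen M g | g. g \<in> G}) \<le>
    ennreal (1 / T) * (\<integral>\<^sup>+ s. ennreal (\<mu> {T *\<^sub>R g s | g. g \<in> G}) \<partial>M)
      + ennreal (\<delta> * (1 + \<mu> (cball 0 ((\<integral>t. \<psi> t \<partial>M) + 2))))"
proof -
  interpret finite_measure M by (rule fin)
  \<comment> \<open>The error budget: moving from \<open>t\<close> to \<open>\<sigma> i\<close> and
    nearly attaining the supremum there cost \<open>\<epsilon>\<close> each, together at most
    \<open>2 * \<epsilon> * T = \<delta> / 2\<close>. The tail costs less than
    \<open>\<delta> / 4\<close>.\<close>
  define \<epsilon> where "\<epsilon> = \<delta> / (4 * T)"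
  have \<epsilon>: "0 < \<epsilon>" using \<delta> T by (simp add: \<epsilon>_def)
  obtain E :: "nat \<Rightarrow> 't set" where E: "range E \<subseteq> sets M" "disjoint_family E"
    "space M - (\<Union>i. E i) \<in> null_sets M"
    and Ebd: "\<forall>i. \<forall>s\<in>E i. \<forall>g\<in>G. norm (g s) \<le> \<psi> s"
    and EJ: "\<forall>i. \<forall>s\<in>E i. \<forall>t\<in>E i. dist (J_fun G s) (J_fun G t) < \<epsilon>"
    using strongly_measurable_partition[OF J bd \<epsilon>] by (elim exE conjE)
  have Es[measurable]: "E i \<in> sets M" for i using E(1) by auto
  have "0 < \<delta> / 4" using \<delta> by simp
  from integral_partition_tail[OF \<psi> E(1,3) this]
  obtain n where n: "(\<integral>t. indicator (space M - (\<Union>i<n. E i)) t * \<psi> t \<partial>M) < \<delta> / 4"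
    by (elim exE)
  \<comment> \<open>Empty pieces are dropped, as they offer no sample point.\<close>
  define I where "I = {i. i < n \<and> E i \<noteq> {}}"
  have I: "finite I" by (simp add: I_def)
  have dis: "disjoint_family_on E I"
    using E(2) by (auto simp: disjoint_family_on_def)
  define W where "W = (\<lambda>s. {T *\<^sub>R g s | g. g \<in> G})"
  have W: "W s \<noteq> {}" "bounded (W s)" if "s \<in> E i" for i s
  proof -
    show "W s \<noteq> {}" using G by (auto simp: W_def)
    have "norm x \<le> T * \<psi> s" if "x \<in> W s" for x
    proof -
      obtain g where "g \<in> G" "x = T *\<^sub>R g s" using \<open>x \<in> W s\<close> by (auto simp: W_def)
      then show ?thesis using Ebd \<open>s \<in> E i\<close> T(2) by (simp add: mult_left_mono)
    qed
    then show "bounded (W s)" unfolding bounded_iff by blast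
  qed
  define c where "c = (\<lambda>i. INF s\<in>E i. \<mu> (W s))"
  have m0: "0 \<le> \<mu> (W s)" if "s \<in> E i" for i s
    using mnc_nonneg[OF \<mu> W[OF that]] .
  have bdd: "bdd_below ((\<lambda>s. \<mu> (W s)) ` E i)" for i
    by (rule bdd_belowI2[of _ 0]) (rule m0)
  have c_le: "c i \<le> \<mu> (W s)" if "s \<in> E i" for i s
    unfolding c_def by (rule cINF_lower[OF bdd that])
  have c0: "0 \<le> c i" if "i \<in> I" for i
    unfolding c_def using that m0 by (intro cINF_greatest) (auto simp: I_def)
  have "\<forall>i\<in>I. \<exists>s. s \<in> E i \<and> \<mu> (W s) < c i + \<delta>"
  proof
    fix i assume "i \<in> I"
    then have ne: "E i \<noteq> {}" by (simp add: I_def)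
    have "(INF s\<in>E i. \<mu> (W s)) < c i + \<delta>" using \<delta> by (simp add: c_def)
    then show "\<exists>s. s \<in> E i \<and> \<mu> (W s) < c i + \<delta>"
      unfolding cINF_less_iff[OF ne bdd] by auto
  qed
  from bchoice[OF this] obtain \<sigma> where "\<forall>i\<in>I. \<sigma> i \<in> E i \<and> \<mu> (W (\<sigma> i)) < c i + \<delta>"
    by (elim exE)
  then have \<sigma>: "\<sigma> i \<in> E i" "\<mu> (W (\<sigma> i)) < c i + \<delta>" if "i \<in> I" for i
    using that by simp_all
  \<comment> \<open>The factor \<open>T\<close> already sits in \<open>W\<close>, so
    \<open>w i\<close> times an element of \<open>W (\<sigma> i)\<close> is
    \<open>measure M (E i)\<close> times a value at \<open>\<sigma> i\<close>.\<close>
  define w where "w = (\<lambda>i. measure M (E i) / T)"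
  have w0: "0 \<le> w i" for i using T by (simp add: w_def)
  have mT: "(\<Sum>i\<in>I. measure M (E i)) \<le> T"
  proof -
    have "(\<Sum>i\<in>I. measure M (E i)) = measure M (\<Union>i\<in>I. E i)"
      using E(1) dis I by (intro finite_measure_finite_Union[symmetric]) auto
    also have "\<dots> \<le> T" unfolding T(1) by (rule bounded_measure)
    finally show ?thesis .
  qed
  have w1: "sum w I \<le> 1"
    using mT T by (simp add: w_def divide_le_eq flip: sum_divide_distrib)
  define S where "S = {\<Sum>i\<in>I. w i *\<^sub>R x i | x. \<forall>i\<in>I. x i \<in> W (\<sigma> i)}"
  have S: "bounded S" "\<mu> S \<le> (\<Sum>i\<in>I. w i * \<mu> (W (\<sigma> i)))"
    unfolding S_def
    using mnc_subconvex_sum[OF \<mu> I, of "\<lambda>i. W (\<sigma> i)" w, OF W(1)[OF \<sigma>(1)] W(2)[OF \<sigma>(1)] w0 w1]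
    by simp_all
  have "(\<Sum>i\<in>I. w i * \<mu> (W (\<sigma> i))) \<le> (\<Sum>i\<in>I. w i * (c i + \<delta>))"
    using w0 \<sigma>(2) by (intro sum_mono mult_left_mono) (auto intro: less_imp_le)
  also have "\<dots> = (\<Sum>i\<in>I. w i * c i) + sum w I * \<delta>"
    by (simp add: distrib_left sum.distrib sum_distrib_right)
  also have "sum w I * \<delta> \<le> 1 * \<delta>"
    using w1 \<delta> by (intro mult_right_mono) auto
  finally have \<mu>S: "\<mu> S \<le> (\<Sum>i\<in>I. w i * c i) + \<delta>" using S(2) by simp

  have functional: "\<exists>h. has_bochner_integral M h (blinfun_apply f (bochner_integral_gen M g)) \<and>
      (AE t in M. h t = blinfun_apply f (g t))"
    if "g \<in> G" "norm f \<le> 1" for g and f :: "'a \<Rightarrow>\<^sub>L real"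
    using has_bochner_integral_gen_functional[OF
        has_bochner_integral_gen_bochner_integral_gen[OF int[OF that(1)]] that(2)] by metis
  define A where "A = {bochner_integral_gen M g | g. g \<in> G}"
  let ?r = "\<integral>t. \<psi> t \<partial>M"
  have A: "A \<noteq> {}" using G by (auto simp: A_def)
  have Ar: "A \<subseteq> cball 0 ?r"
  proof
    fix x assume "x \<in> A"
    then obtain g where g: "g \<in> G" "x = bochner_integral_gen M g" by (auto simp: A_def)
    have "norm x \<le> ?r"
    proof (rule norm_le_if_functionals_le)
      fix f :: "'a \<Rightarrow>\<^sub>L real" assume f: "norm f \<le> 1"
      obtain h where h: "has_bochner_integral M h (blinfun_apply f x)"
        "AE t in M. h t = blinfun_apply f (g t)"
        using functional[OF g(1) f] unfolding g(2) by (elim exE conjE)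
      have "(\<integral>t. h t \<partial>M) \<le> ?r"
      proof (rule integral_mono_AE[OF integrable.intros[OF h(1)] \<psi>])
        show "AE t in M. h t \<le> \<psi> t"
          using h(2) bd
        proof eventually_elim
          fix t assume "h t = blinfun_apply f (g t)" "\<forall>g\<in>G. norm (g t) \<le> \<psi> t"
          moreover have "\<bar>blinfun_apply f (g t)\<bar> \<le> norm f * norm (g t)"
            using norm_blinfun[of f "g t"] by simp
          moreover have "norm f * norm (g t) \<le> 1 * norm (g t)"
            using f by (intro mult_right_mono) auto
          ultimately show "h t \<le> \<psi> t" using g(1) by force
        qed
      qed
      then show "blinfun_apply f x \<le> ?r"
        using has_bochner_integral_integral_eq[OF h(1)] by simp
    qed
    then show "x \<in> cball 0 ?r" by simp
  qed
  have near: "\<exists>y\<in>S. blinfun_apply f x < blinfun_apply f y + \<delta>"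
    if x: "x \<in> A" and f: "norm f \<le> 1" for x and f :: "'a \<Rightarrow>\<^sub>L real"
  proof -
    obtain g where g: "g \<in> G" "x = bochner_integral_gen M g" using x by (auto simp: A_def)
    obtain h where h: "has_bochner_integral M h (blinfun_apply f x)"
      "AE t in M. h t = blinfun_apply f (g t)"
      using functional[OF g(1) f] unfolding g(2) by (elim exE conjE)
    define J where "J = (\<lambda>s. apply_bcontfun (J_fun G s) (Dual_ball f))"
    define R where "R = space M - (\<Union>i<n. E i)"
    have R[measurable]: "R \<in> sets M" by (simp add: R_def)
    \<comment> \<open>An integrable majorant of the scalar function \<open>h\<close>: a step
      function built from the support functional on the chosen pieces, and \<open>\<psi>\<close> on
      the remainder.\<close>
    define b where "b = (\<lambda>t. (\<Sum>i\<in>I. (J (\<sigma> i) + \<epsilon>) * indicator (E i) t) + indicator R t * \<psi> t)"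
    have int1: "integrable M (\<lambda>t. (J (\<sigma> i) + \<epsilon>) * indicator (E i) t)" for i
      by (intro integrable_mult_right integrable_real_indicator Es) (simp add: less_top[symmetric])
    have int2: "integrable M (\<lambda>t. indicator R t * \<psi> t)"
      using integrable_mult_indicator[OF R \<psi>] by simp
    have "(\<integral>t. h t \<partial>M) \<le> (\<integral>t. b t \<partial>M)"
    proof (rule integral_mono_AE[OF integrable.intros[OF h(1)]])
      show "integrable M b"
        unfolding b_def by (intro Bochner_Integration.integrable_add Bochner_Integration.integrable_sum int1 int2)
      have "AE t in M. t \<notin> space M - (\<Union>i. E i)" using E(3) by (rule AE_not_in)
      then show "AE t in M. h t \<le> b t"
        using h(2) AE_space
      proof eventually_elim
        fix t assume "t \<notin> space M - (\<Union>i. E i)" and ht: "h t = blinfun_apply f (g t)"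
          and tM: "t \<in> space M"
        then obtain i where ti: "t \<in> E i" by auto
        have Et: "\<forall>g\<in>G. norm (g t) \<le> \<psi> t" using Ebd ti by blast
        show "h t \<le> b t"
        proof (cases "i < n")
          case True
          then have i: "i \<in> I" using ti by (auto simp: I_def)
          have "h t \<le> J t" unfolding ht J_def by (rule functional_le_J_fun[OF g(1) Et f])
          also have "\<dots> \<le> J (\<sigma> i) + \<epsilon>"
          proof -
            have "dist (J_fun G t) (J_fun G (\<sigma> i)) < \<epsilon>" using EJ ti \<sigma>(1)[OF i] by blast
            then show ?thesis
              using dist_fun_lt_imp_dist_val_lt[of "J_fun G t" "J_fun G (\<sigma> i)" \<epsilon> "Dual_ball f"]
              unfolding J_def dist_real_def by linarith
          qed
          also have "\<dots> = (\<Sum>i\<in>I. (J (\<sigma> i) + \<epsilon>) * indicator (E i) t)"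
            using sum_indicator_disjoint_family[OF dis ti I i, of "\<lambda>i. J (\<sigma> i) + \<epsilon>"] by simp
          finally have "h t \<le> (\<Sum>i\<in>I. (J (\<sigma> i) + \<epsilon>) * indicator (E i) t)" .
          moreover have "t \<notin> R" using ti True by (auto simp: R_def)
          ultimately show ?thesis by (simp add: b_def)
        next
          case False
          have notin: "t \<notin> E j" if "j < n" for j
            using disjoint_family_onD[OF E(2), of i j] ti False that by auto
          have "(\<Sum>i\<in>I. (J (\<sigma> i) + \<epsilon>) * indicator (E i) t) = 0"
            by (intro sum.neutral ballI) (use notin in \<open>simp add: I_def\<close>)
          moreover have "t \<in> R" using notin tM by (auto simp: R_def)
          moreover have "h t \<le> \<psi> t"
          proof -
            have "\<bar>blinfun_apply f (g t)\<bar> \<le> norm f * norm (g t)"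
              using norm_blinfun[of f "g t"] by simp
            also have "\<dots> \<le> 1 * \<psi> t"
              using f bspec[OF Et g(1)] by (intro mult_mono) auto
            finally show ?thesis using ht by simp
          qed
          ultimately show ?thesis by (simp add: b_def)
        qed
      qed
    qed
    also have "(\<integral>t. b t \<partial>M) = (\<Sum>i\<in>I. (J (\<sigma> i) + \<epsilon>) * measure M (E i)) + (\<integral>t. indicator R t * \<psi> t \<partial>M)"
      unfolding b_def using int1 int2
      by (subst Bochner_Integration.integral_add)
        (simp_all add: Bochner_Integration.integral_sum Int_absorb2 sets.sets_into_space[OF Es])
    also have "\<dots> < (\<Sum>i\<in>I. (J (\<sigma> i) + \<epsilon>) * measure M (E i)) + \<delta> / 4"
      using n by (simp add: R_def)
    finally have 1: "blinfun_apply f x < (\<Sum>i\<in>I. (J (\<sigma> i) + \<epsilon>) * measure M (E i)) + \<delta> / 4"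
      using has_bochner_integral_integral_eq[OF h(1)] by simp
    \<comment> \<open>The near-maximiser depends on \<open>i\<close> and on \<open>f\<close>, so
      \<open>y\<close> need not be a Riemann sum of a single member of \<open>G\<close>. This is why
      \<open>S\<close> admits independent choices on the pieces.\<close>
    have "\<forall>i\<in>I. \<exists>k. k \<in> G \<and> J (\<sigma> i) - \<epsilon> < blinfun_apply f (k (\<sigma> i))"
    proof
      fix i assume i: "i \<in> I"
      have "\<forall>g\<in>G. norm (g (\<sigma> i)) \<le> \<psi> (\<sigma> i)" using Ebd \<sigma>(1)[OF i] by blast
      from less_J_funD[OF G this f, of "J (\<sigma> i) - \<epsilon>"]
      show "\<exists>k. k \<in> G \<and> J (\<sigma> i) - \<epsilon> < blinfun_apply f (k (\<sigma> i))"
        using \<epsilon> by (simp add: J_def Bex_def)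
    qed
    from bchoice[OF this] obtain k
      where k: "\<forall>i\<in>I. k i \<in> G \<and> J (\<sigma> i) - \<epsilon> < blinfun_apply f (k i (\<sigma> i))" by (elim exE)
    define y where "y = (\<Sum>i\<in>I. w i *\<^sub>R (T *\<^sub>R k i (\<sigma> i)))"
    have "y \<in> S"
      unfolding S_def y_def
      by (intro CollectI exI[of _ "\<lambda>i. T *\<^sub>R k i (\<sigma> i)"]) (use k in \<open>auto simp: W_def\<close>)
    moreover have "blinfun_apply f x < blinfun_apply f y + \<delta>"
    proof -
      have "(\<Sum>i\<in>I. (J (\<sigma> i) + \<epsilon>) * measure M (E i))
          \<le> (\<Sum>i\<in>I. (blinfun_apply f (k i (\<sigma> i)) + 2 * \<epsilon>) * measure M (E i))"
      proof (intro sum_mono mult_right_mono)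
        fix i assume "i \<in> I"
        then show "J (\<sigma> i) + \<epsilon> \<le> blinfun_apply f (k i (\<sigma> i)) + 2 * \<epsilon>" using bspec[OF k] by force
      qed simp
      also have "\<dots> = (\<Sum>i\<in>I. blinfun_apply f (k i (\<sigma> i)) * measure M (E i))
          + 2 * \<epsilon> * (\<Sum>i\<in>I. measure M (E i))"
        by (simp add: distrib_right sum.distrib sum_distrib_left)
      also have "(\<Sum>i\<in>I. blinfun_apply f (k i (\<sigma> i)) * measure M (E i)) = blinfun_apply f y"
        using T(2) by (simp add: y_def w_def blinfun.sum_right blinfun.scaleR_right mult.commute)
      also have "2 * \<epsilon> * (\<Sum>i\<in>I. measure M (E i)) \<le> 2 * \<epsilon> * T"
        using mT \<epsilon> by (intro mult_left_mono) auto
      also have "2 * \<epsilon> * T = \<delta> / 2" using T(2) by (simp add: \<epsilon>_def)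
      finally show ?thesis using 1 \<delta>(1) by simp
    qed
    ultimately show ?thesis by blast
  qed
  let ?L = "\<mu> (cball 0 (?r + 2))"
  obtain x0 where "x0 \<in> A" using A by blast
  then have "norm x0 \<le> ?r" using Ar by auto
  then have r0: "0 \<le> ?r" using norm_ge_zero[of x0] by linarith
  have L: "0 \<le> ?L" by (rule mnc_nonneg[OF \<mu>]) (use r0 in simp_all)
  have Sne: "S \<noteq> {}"
  proof -
    have "\<exists>f::'a \<Rightarrow>\<^sub>L real. norm f \<le> 1" by (rule exI[of _ 0]) simp
    then show ?thesis using near[OF \<open>x0 \<in> A\<close>] by blast
  qed
  have "\<mu> A \<le> \<mu> S + \<delta> * ?L"
    by (rule mnc_near_functionals[OF \<mu> A Ar Sne S(1) \<delta> near])
  also have "\<dots> \<le> (\<Sum>i\<in>I. w i * c i) + \<delta> * (1 + ?L)"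
    using \<mu>S by (simp add: distrib_left)
  finally have "ennreal (\<mu> A) \<le> ennreal ((\<Sum>i\<in>I. w i * c i) + \<delta> * (1 + ?L))"
    by (rule ennreal_leI)
  also have "\<dots> = ennreal (\<Sum>i\<in>I. w i * c i) + ennreal (\<delta> * (1 + ?L))"
    using w0 c0 \<delta> L by (intro ennreal_plus sum_nonneg mult_nonneg_nonneg) auto
  also have "ennreal (\<Sum>i\<in>I. w i * c i) \<le> ennreal (1 / T) * (\<integral>\<^sup>+ s. ennreal (\<mu> (W s)) \<partial>M)"
  proof -
    have "(\<Sum>i\<in>I. w i * c i) = (1 / T) * (\<Sum>i\<in>I. c i * measure M (E i))"
      by (simp add: w_def sum_distrib_left mult.commute)
    also have "ennreal \<dots> = ennreal (1 / T) * ennreal (\<Sum>i\<in>I. c i * measure M (E i))"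
      by (rule ennreal_mult) (use T(2) c0 in \<open>auto intro: sum_nonneg\<close>)
    also have "ennreal (\<Sum>i\<in>I. c i * measure M (E i)) = (\<Sum>i\<in>I. ennreal (c i) * emeasure M (E i))"
      using c0 by (simp add: sum_ennreal[symmetric] ennreal_mult emeasure_eq_measure)
    also have "\<dots> = (\<integral>\<^sup>+ s. (\<Sum>i\<in>I. ennreal (c i) * indicator (E i) s) \<partial>M)"
      by (subst nn_integral_sum) (auto simp: nn_integral_cmult_indicator)
    \<comment> \<open>The step function with values \<open>c i\<close> lies pointwise below the
      integrand, so monotonicity alone compares the integrals, even when the right one is
      infinite.\<close>
    also have "\<dots> \<le> (\<integral>\<^sup>+ s. ennreal (\<mu> (W s)) \<partial>M)"
    proof (rule nn_integral_mono)
      fix s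
      show "(\<Sum>i\<in>I. ennreal (c i) * indicator (E i) s) \<le> ennreal (\<mu> (W s))"
      proof (cases "\<exists>i\<in>I. s \<in> E i")
        case True
        then obtain i where i: "i \<in> I" "s \<in> E i" by blast
        then show ?thesis
          using sum_indicator_disjoint_family[OF dis i(2) I i(1), of "\<lambda>i. ennreal (c i)"]
            c_le[OF i(2)] by (simp add: ennreal_leI)
      next
        case False
        then have "(\<Sum>i\<in>I. ennreal (c i) * indicator (E i) s) = 0"
          by (intro sum.neutral ballI) (simp add: indicator_def)
        then show ?thesis by simp
      qed
    qed
    finally show ?thesis by (simp add: mult_left_mono)
  qed
  finally show ?thesis unfolding A_def W_def by (simp add: add_right_mono)
qed


section \<open>Passage to the limit and specialisation to the interval\<close>

lemma mnc_bochner_integral_le: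
  fixes G :: "('t \<Rightarrow> 'a::banach) set"
  assumes \<mu>: "convex_mnc \<mu>" and fin: "finite_measure M" and T: "T = measure M (space M)" "0 < T"
    and G: "G \<noteq> {}" and int: "\<And>g. g \<in> G \<Longrightarrow> bochner_integrable_gen M g"
    and \<psi>: "integrable M \<psi>" and bd: "AE t in M. \<forall>g\<in>G. norm (g t) \<le> \<psi> t"
    and J: "strongly_measurable M (J_fun G)"
  shows "ennreal (\<mu> {bochner_integral_gen M g | g. g \<in> G}) \<le>
    ennreal (1 / T) * (\<integral>\<^sup>+ s. ennreal (\<mu> {T *\<^sub>R g s | g. g \<in> G}) \<partial>M)"
proof (rule ennreal_le_epsilon)
  fix e :: real assume e: "0 < e"
  let ?L = "\<mu> (cball 0 ((\<integral>t. \<psi> t \<partial>M) + 2))"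
  have "0 \<le> (\<integral>t. \<psi> t \<partial>M)"
  proof (rule integral_nonneg_AE)
    obtain g where "g \<in> G" using G by auto
    show "AE t in M. 0 \<le> \<psi> t"
      using bd
    proof eventually_elim
      fix t assume "\<forall>g\<in>G. norm (g t) \<le> \<psi> t"
      then have "norm (g t) \<le> \<psi> t" using \<open>g \<in> G\<close> by (rule bspec)
      then show "0 \<le> \<psi> t" using norm_ge_zero[of "g t"] by linarith
    qed
  qed
  then have L: "0 \<le> ?L" by (intro mnc_nonneg[OF \<mu>]) simp_all
  \<comment> \<open>Chosen so that the error \<open>\<delta> * (1 + ?L)\<close> is at most
    \<open>e\<close>; \<open>?L\<close> does not depend on \<open>\<delta>\<close>.\<close>
  define \<delta> where "\<delta> = min 1 (e / (1 + ?L))"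
  have \<delta>: "0 < \<delta>" "\<delta> \<le> 1" using e L by (simp_all add: \<delta>_def)
  have "\<delta> * (1 + ?L) \<le> e / (1 + ?L) * (1 + ?L)"
    using L by (intro mult_right_mono) (simp_all add: \<delta>_def)
  then have "\<delta> * (1 + ?L) \<le> e" using L by simp
  then show "ennreal (\<mu> {bochner_integral_gen M g | g. g \<in> G}) \<le>
    ennreal (1 / T) * (\<integral>\<^sup>+ s. ennreal (\<mu> {T *\<^sub>R g s | g. g \<in> G}) \<partial>M) + ennreal e"
    using mnc_bochner_integral_approx[OF \<mu> fin T G int \<psi> bd J \<delta>]
    by (meson add_left_mono ennreal_leI order_trans)
qed

theorem theorem4p8:
  fixes \<mu> :: "'a::banach set \<Rightarrow> real"
    and a :: real
    and G :: "(real \<Rightarrow> 'a) set"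
    and \<psi> :: "real \<Rightarrow> real"
  assumes "\<not> (\<exists>B::'a set. finite B \<and> span B = UNIV)"
    and "convex_mnc \<mu>"
    and "0 < a"
    and "G \<noteq> {}"
    and "G \<subseteq> L1_space (lebesgue_on {0..a})"
    and "L1_bounded (lebesgue_on {0..a}) G"
    and "integrable (lebesgue_on {0..a}) \<psi>"
    and "\<forall>t\<in>{0..a}. 0 \<le> \<psi> t"
    and "AE t in lebesgue_on {0..a}. \<forall>g\<in>G. norm (g t) \<le> \<psi> t"
    and "strongly_measurable (lebesgue_on {0..a}) (J_fun G)"
  shows "(\<lambda>t. \<mu> {g t | g. g \<in> G}) \<in> borel_measurable (lebesgue_on {0..a}) \<and>
    (\<forall>t. 0 < t \<and> t \<le> a \<longrightarrow>
      ennreal (\<mu> {bochner_integral_gen (lebesgue_on {0..t}) g | g. g \<in> G})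
        \<le> ennreal (1 / t) *
           (\<integral>\<^sup>+ s. ennreal (\<mu> {t *\<^sub>R g s | g. g \<in> G}) \<partial>lebesgue_on {0..t}))"
proof (intro conjI allI impI)
  let ?M = "lebesgue_on {0..a}"
  show "(\<lambda>t. \<mu> {g t | g. g \<in> G}) \<in> borel_measurable ?M"
    by (rule borel_measurable_mnc_family[OF assms(2,4) _ assms(9,10)]) simp
  fix t assume t: "0 < t \<and> t \<le> a"
  have S: "{0..t} \<in> sets ?M" using t by (simp add: sets_restrict_space_iff)
  have SM: "{0..t} \<inter> space ?M \<in> sets ?M" using t S by auto
  have min: "min a t = t" using t by simp
  have R: "restrict_space ?M {0..t} = lebesgue_on {0..t}"
    by (subst restrict_restrict_space) (simp_all add: min)
  show "ennreal (\<mu> {bochner_integral_gen (lebesgue_on {0..t}) g | g. g \<in> G})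
    \<le> ennreal (1 / t) * (\<integral>\<^sup>+ s. ennreal (\<mu> {t *\<^sub>R g s | g. g \<in> G}) \<partial>lebesgue_on {0..t})"
  \<comment> \<open>The measure space is \<open>lebesgue_on {0..t}\<close>, of total mass
    \<open>T = t\<close>. The hypotheses on \<open>{0..a}\<close> pass to it by restriction, as
    \<open>J_fun G\<close> does not refer to the measure.\<close>
  proof (rule mnc_bochner_integral_le[OF assms(2) _ _ _ assms(4)])
    show "finite_measure (lebesgue_on {0..t})"
      by (rule finite_measureI) (use t in \<open>simp add: emeasure_restrict_space\<close>)
    show "t = measure (lebesgue_on {0..t}) (space (lebesgue_on {0..t}))" "0 < t"
      using t by (simp_all add: measure_restrict_space)
    show "bochner_integrable_gen (lebesgue_on {0..t}) g" if "g \<in> G" for g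
      using bochner_integrable_gen_restrict_space[OF _ S, of g] that assms(5)
      unfolding R by (auto simp: L1_space_def)
    show "integrable (lebesgue_on {0..t}) \<psi>"
      using integrable_restrict_space[OF SM, of \<psi>] integrable_mult_indicator[OF S assms(7)]
      unfolding R by simp
    show "AE s in lebesgue_on {0..t}. \<forall>g\<in>G. norm (g s) \<le> \<psi> s"
      using assms(9) unfolding R[symmetric] AE_restrict_space_iff[OF SM]
      by (rule eventually_mono) simp
    show "strongly_measurable (lebesgue_on {0..t}) (J_fun G)"
      using strongly_measurable_restrict_space[OF assms(10) S] unfolding R .
  qed
qed

end
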